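(* There exist absolute constants $c>0$ and $C>0$ such that the following holds. Let $n\ge 2$ be an integer and let $L,\mu,\Delta,\varepsilon>0$ satisfy $\kappa:=L/\mu\ge n/2+1$ and $\varepsilon/\Delta\le 0.00327$. Then for every PIFO algorithm $\mathcal{A}$ there exist a dimension $d\le C\sqrt{\kappa/n}\,\log(\Delta/\varepsilon)$ and $n$ functions $f_1,\dots,f_n:\mathbb{R}^d\to\mathbb{R}$, each $L$-smooth and $\mu$-strongly convex, such that $f=\frac1n\sum_{i=1}^n f_i$ satisfies $f(x_0)-f(x^* )=\Delta$ (where $x^*$ is the minimizer of $f$ and $x_0$ the initial point of $\mathcal{A}$), and the iterates of $\mathcal{A}$ run on $f_1,\dots,f_n$ satisfy $\mathbb{E} f(x_t)-f(x^* )\ge\varepsilon$ for all integers $0\le t\le c\,(n+\sqrt{\kappa n})\log(\Delta/\varepsilon)$. In other words, $\mathcal{A}$ needs $\Omega\big((n+\sqrt{\kappa n})\log(\Delta/\varepsilon)\big)$ oracle queries to find $\hat x$ with $\mathbb{E} f(\hat x)-f(x^* )<\varepsilon$.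
   Context: A differentiable $g:\mathbb{R}^d\to\mathbb{R}$ is $L$-smooth if $\|\nabla g(x)-\nabla g(y)\|_2\le L\|x-y\|_2$ for all $x,y$, and $\mu$-strongly convex if $g(y)\ge g(x)+\langle\nabla g(x),y-x\rangle+\frac{\mu}{2}\|y-x\|_2^2$ for all $x,y$. For $\gamma>0$, $\mathrm{prox}^{\gamma}_g(x)=\arg\min_u\{g(u)+\frac{1}{2\gamma}\|x-u\|_2^2\}$. PIFO algorithm: given $f_1,\dots,f_n:\mathbb{R}^d\to\mathbb{R}$ and $f=\frac1n\sum_i f_i$, a PIFO algorithm $\mathcal{A}$ is specified by a probability vector $(p_1,\dots,p_n)$ ($p_j\ge0$, $\sum_j p_j=1$), an initial point $x_0$ and parameters $\gamma_t>0$; it draws indices $i_1,i_2,\dots$ independently with $\mathbb{P}(i_t=j)=p_j$, at step $t\ge1$ queries the oracle $h_f(x_{t-1},i_t,\gamma_t)=[f_{i_t}(x_{t-1}),\nabla f_{i_t}(x_{t-1}),\mathrm{prox}^{\gamma_t}_{f_{i_t}}(x_{t-1})]$, and outputs an iterate $x_t\in\mathrm{span}\{x_0,\dots,x_{t-1},\nabla f_{i_1}(x_0),\dots,\nabla f_{i_t}(x_{t-1}),\mathrm{prox}^{\gamma_1}_{f_{i_1}}(x_0),\dots,\mathrm{prox}^{\gamma_t}_{f_{i_t}}(x_{t-1})\}$ (the choice within the span may depend on all previously observed information). Iterate $x_t$ uses $t$ oracle queries. *)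

theory Defs
  imports Complex_Main "HOL-Library.FuncSet"
begin

text \<open>Vectors of R^d are represented as functions nat => real vanishing from index d on.
  Coordinates are 0..d-1.\<close>

type_synonym vecn = "nat \<Rightarrow> real"

definition Rd :: "nat \<Rightarrow> vecn set" where
  "Rd d = {x. \<forall>i\<ge>d. x i = 0}"

definition inner_d :: "nat \<Rightarrow> vecn \<Rightarrow> vecn \<Rightarrow> real" where
  "inner_d d x y = (\<Sum>i<d. x i * y i)"

definition norm_d :: "nat \<Rightarrow> vecn \<Rightarrow> real" where
  "norm_d d x = sqrt (\<Sum>i<d. (x i)^2)"

definition has_grad_d :: "nat \<Rightarrow> (vecn \<Rightarrow> real) \<Rightarrow> vecn \<Rightarrow> vecn \<Rightarrow> bool" where
  "has_grad_d d f g x \<longleftrightarrow> g \<in> Rd d \<and>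
     (\<forall>e>0. \<exists>\<delta>>0. \<forall>h\<in>Rd d. norm_d d h < \<delta> \<longrightarrow>
        \<bar>f (\<lambda>i. x i + h i) - f x - inner_d d g h\<bar> \<le> e * norm_d d h)"

definition differentiable_d :: "nat \<Rightarrow> (vecn \<Rightarrow> real) \<Rightarrow> bool" where
  "differentiable_d d f \<longleftrightarrow> (\<forall>x\<in>Rd d. \<exists>g. has_grad_d d f g x)"

definition grad_d :: "nat \<Rightarrow> (vecn \<Rightarrow> real) \<Rightarrow> vecn \<Rightarrow> vecn" where
  "grad_d d f x = (THE g. has_grad_d d f g x)"

definition L_smooth :: "nat \<Rightarrow> real \<Rightarrow> (vecn \<Rightarrow> real) \<Rightarrow> bool" where
  "L_smooth d L f \<longleftrightarrow> differentiable_d d f \<and>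
     (\<forall>x\<in>Rd d. \<forall>y\<in>Rd d. norm_d d (\<lambda>i. grad_d d f x i - grad_d d f y i) \<le> L * norm_d d (\<lambda>i. x i - y i))"

definition strongly_convex :: "nat \<Rightarrow> real \<Rightarrow> (vecn \<Rightarrow> real) \<Rightarrow> bool" where
  "strongly_convex d \<mu> f \<longleftrightarrow> differentiable_d d f \<and>
     (\<forall>x\<in>Rd d. \<forall>y\<in>Rd d.
        f y \<ge> f x + inner_d d (grad_d d f x) (\<lambda>i. y i - x i) + \<mu> / 2 * (norm_d d (\<lambda>i. y i - x i))^2)"

definition prox_d :: "nat \<Rightarrow> real \<Rightarrow> (vecn \<Rightarrow> real) \<Rightarrow> vecn \<Rightarrow> vecn" where
  "prox_d d \<gamma> g x = (THE u. u \<in> Rd d \<and>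
     (\<forall>v\<in>Rd d. g u + (norm_d d (\<lambda>i. x i - u i))^2 / (2 * \<gamma>) \<le> g v + (norm_d d (\<lambda>i. x i - v i))^2 / (2 * \<gamma>)))"

text \<open>An oracle answer: (index i_t, f_{i_t}(x_{t-1}), gradient, prox).
  A history is the list of answers received so far.
  An algorithm's iterate rule A :: nat => history => vecn maps the dimension d and
  the history of length t to the iterate x_t (A d [] is the initial point x_0).\<close>
type_synonym answer = "nat \<times> real \<times> vecn \<times> vecn"
type_synonym iter_rule = "nat \<Rightarrow> answer list \<Rightarrow> vecn"

definition in_span :: "vecn list \<Rightarrow> vecn \<Rightarrow> bool" where
  "in_span vs x \<longleftrightarrow> (\<exists>c::nat \<Rightarrow> real. x = (\<lambda>k. \<Sum>j<length vs. c j * (vs ! j) k))"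

definition span_gens :: "iter_rule \<Rightarrow> nat \<Rightarrow> answer list \<Rightarrow> vecn list" where
  "span_gens A d hs =
     map (\<lambda>k. A d (take k hs)) [0..<length hs]
     @ map (\<lambda>a. fst (snd (snd a))) hs
     @ map (\<lambda>a. snd (snd (snd a))) hs"

definition pifo_alg :: "nat \<Rightarrow> (nat \<Rightarrow> real) \<Rightarrow> (nat \<Rightarrow> real) \<Rightarrow> iter_rule \<Rightarrow> bool" where
  "pifo_alg n p gam A \<longleftrightarrow>
     (\<forall>j<n. p j \<ge> 0) \<and> (\<Sum>j<n. p j) = 1 \<and> (\<forall>t\<ge>1. gam t > 0) \<and>
     (\<forall>d. A d [] \<in> Rd d) \<and>
     (\<forall>d hs. hs \<noteq> [] \<longrightarrow> in_span (span_gens A d hs) (A d hs))"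

text \<open>History after k queries, for component functions fs and index sequence is
  (is k = i_{k+1}); query number k+1 uses parameter gam (k+1).\<close>
primrec hist :: "iter_rule \<Rightarrow> (nat \<Rightarrow> real) \<Rightarrow> nat \<Rightarrow> (nat \<Rightarrow> vecn \<Rightarrow> real) \<Rightarrow> (nat \<Rightarrow> nat) \<Rightarrow> nat \<Rightarrow> answer list" where
  "hist A gam d fs is 0 = []"
| "hist A gam d fs is (Suc k) =
     (let h = hist A gam d fs is k; x = A d h; i = is k in
      h @ [(i, fs i x, grad_d d (fs i) x, prox_d d (gam (Suc k)) (fs i) x)])"

definition iterate :: "iter_rule \<Rightarrow> (nat \<Rightarrow> real) \<Rightarrow> nat \<Rightarrow> (nat \<Rightarrow> vecn \<Rightarrow> real) \<Rightarrow> (nat \<Rightarrow> nat) \<Rightarrow> nat \<Rightarrow> vecn" where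
  "iterate A gam d fs is t = A d (hist A gam d fs is t)"

definition avg_fun :: "nat \<Rightarrow> (nat \<Rightarrow> vecn \<Rightarrow> real) \<Rightarrow> vecn \<Rightarrow> real" where
  "avg_fun n fs x = (\<Sum>i<n. fs i x) / real n"

definition expect_iter :: "nat \<Rightarrow> (nat \<Rightarrow> real) \<Rightarrow> (nat \<Rightarrow> real) \<Rightarrow> iter_rule \<Rightarrow> nat \<Rightarrow>
    (nat \<Rightarrow> vecn \<Rightarrow> real) \<Rightarrow> (vecn \<Rightarrow> real) \<Rightarrow> nat \<Rightarrow> real" where
  "expect_iter n p gam A d fs g t =
     (\<Sum>is\<in>PiE {..<t} (\<lambda>_. {..<n}). (\<Prod>k<t. p (is k)) * g (iterate A gam d fs is t))"

end

theory Submission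
  imports Defs
begin

text \<open>
  Two indices \<open>a\<close>, \<open>b\<close> have probability at most \<open>2/n\<close>. Nesterov's chain, whose links
  \<open>(y\<^sub>l - y\<^sub>l\<^sub>+\<^sub>1)\<^sup>2\<close> are given alternately to \<open>f\<^sub>a\<close> and \<open>f\<^sub>b\<close>, makes every gradient and every
  proximal step extend the support by at most one coordinate, and only if the one component owning
  the next link is drawn; the other components are pure quadratics. The average has condition
  number of order \<open>\<kappa>/n\<close> and minimizer \<open>y\<^sub>l = W q\<^sup>l\<close> with \<open>1 - q\<close> of order \<open>\<surd>(n/\<kappa>)\<close>, and a point
  supported on the first \<open>k\<close> coordinates has gap at least \<open>q\<^sup>2\<^sup>k\<Delta>\<close>. As \<open>k\<close> grows with conditional
  probability at most \<open>2/n\<close>, the expectation of \<open>q\<^sup>2\<^sup>k\<close> after \<open>t\<close> queries is at least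
  \<open>(1 - 2(1 - q\<^sup>2)/n)\<^sup>t\<close>.

  The span of the iterates contains \<open>x\<^sub>0\<close>, so a translation cannot reduce to \<open>x\<^sub>0 = 0\<close>. Instead a
  Householder reflection moves \<open>x\<^sub>0\<close> onto an additional coordinate that is decoupled from the chain.
\<close>

section \<open>Gradients and proximal points of quadratics\<close>

lemma inner_d_add_left: "inner_d d (\<lambda>i. x i + y i) z = inner_d d x z + inner_d d y z"
  by (simp add: inner_d_def sum.distrib algebra_simps)

lemma inner_d_diff_left: "inner_d d (\<lambda>i. x i - y i) z = inner_d d x z - inner_d d y z"
  by (simp add: inner_d_def sum_subtractf algebra_simps)

lemma inner_d_scale_left: "inner_d d (\<lambda>i. c * x i) z = c * inner_d d x z"
  by (simp add: inner_d_def sum_distrib_left algebra_simps)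

lemma inner_d_commute: "inner_d d x y = inner_d d y x"
  by (simp add: inner_d_def mult.commute)

lemma inner_d_add_right: "inner_d d z (\<lambda>i. x i + y i) = inner_d d z x + inner_d d z y"
  by (simp add: inner_d_def sum.distrib algebra_simps)

lemma inner_d_diff_right: "inner_d d z (\<lambda>i. x i - y i) = inner_d d z x - inner_d d z y"
  by (simp add: inner_d_def sum_subtractf algebra_simps)

lemma inner_d_scale_right: "inner_d d z (\<lambda>i. c * x i) = c * inner_d d z x"
  by (simp add: inner_d_def sum_distrib_left algebra_simps)

lemmas inner_d_linear = inner_d_add_left inner_d_diff_left inner_d_scale_left
  inner_d_add_right inner_d_diff_right inner_d_scale_right

lemma inner_d_self_nonneg: "0 \<le> inner_d d x x"
  by (simp add: inner_d_def sum_nonneg)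

lemma norm_d_sq: "(norm_d d x)\<^sup>2 = inner_d d x x"
  by (simp add: norm_d_def inner_d_def power2_eq_square sum_nonneg)

lemma norm_d_eq_sqrt: "norm_d d x = sqrt (inner_d d x x)"
  by (simp add: norm_d_def inner_d_def power2_eq_square)

lemma norm_d_nonneg: "0 \<le> norm_d d x"
  by (simp add: norm_d_eq_sqrt inner_d_self_nonneg)

lemma norm_d_scale: "norm_d d (\<lambda>i. c * x i) = \<bar>c\<bar> * norm_d d x"
  by (simp add: norm_d_def power_mult_distrib sum_distrib_left [symmetric] real_sqrt_mult)

lemma inner_d_self_eq_0:
  assumes "x \<in> Rd d" "inner_d d x x = 0"
  shows "x = (\<lambda>i. 0)"
proof
  fix i
  have "\<forall>i<d. x i = 0"
    using assms(2) by (simp add: inner_d_def sum_nonneg_eq_0_iff)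
  then show "x i = 0"
    using assms(1) by (cases "i < d") (auto simp: Rd_def)
qed

text \<open>Nonnegativity of \<open>|x - y|^2\<close> and \<open>|x + y|^2\<close> suffices, in
  place of Cauchy-Schwarz.\<close>

lemma inner_d_le_of_contraction:
  assumes "inner_d d y y \<le> inner_d d x x"
  shows "\<bar>inner_d d x y\<bar> \<le> inner_d d x x"
proof -
  have "0 \<le> inner_d d (\<lambda>i. x i - y i) (\<lambda>i. x i - y i)"
    and "0 \<le> inner_d d (\<lambda>i. x i + y i) (\<lambda>i. x i + y i)"
    by (rule inner_d_self_nonneg)+
  then show ?thesis
    using assms by (simp add: inner_d_linear inner_d_commute [of d y x])
qed

text \<open>\<open>grad_d\<close> is a definite description, so a gradient computed by hand
  identifies it only through uniqueness. Both expansions are compared along the difference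
  \<open>D\<close> of the two candidates.\<close>

lemma has_grad_d_unique:
  assumes g: "has_grad_d d f g x" and g': "has_grad_d d f g' x"
  shows "g = g'"
proof -
  define D where "D = (\<lambda>i. g i - g' i)"
  have DR: "D \<in> Rd d"
    using g g' by (auto simp: has_grad_d_def Rd_def D_def)
  have "norm_d d D \<le> 2 * e" if e: "e > 0" for e
  proof (cases "norm_d d D = 0")
    case True
    then show ?thesis using e by simp
  next
    case False
    then have pos: "norm_d d D > 0"
      using norm_d_nonneg [of d D] by simp
    obtain \<delta> where \<delta>: "\<delta> > 0" "\<And>h. h \<in> Rd d \<Longrightarrow> norm_d d h < \<delta> \<Longrightarrow>
        \<bar>f (\<lambda>i. x i + h i) - f x - inner_d d g h\<bar> \<le> e * norm_d d h"
      using g e by (auto simp: has_grad_d_def)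
    obtain \<delta>' where \<delta>': "\<delta>' > 0" "\<And>h. h \<in> Rd d \<Longrightarrow> norm_d d h < \<delta>' \<Longrightarrow>
        \<bar>f (\<lambda>i. x i + h i) - f x - inner_d d g' h\<bar> \<le> e * norm_d d h"
      using g' e by (auto simp: has_grad_d_def)
    \<comment> \<open>This scaling gives \<open>h\<close> half the smaller radius as its norm,
      strictly inside both neighbourhoods.\<close>
    define \<tau> where "\<tau> = min \<delta> \<delta>' / (2 * norm_d d D)"
    define h where "h = (\<lambda>i. \<tau> * D i)"
    have \<tau>: "\<tau> > 0" using \<delta> \<delta>' pos by (simp add: \<tau>_def)
    have hR: "h \<in> Rd d" using DR by (auto simp: Rd_def h_def)
    have nh: "norm_d d h = \<tau> * norm_d d D"
      using \<tau> by (simp add: h_def norm_d_scale)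
    also have "\<dots> = min \<delta> \<delta>' / 2" using pos by (simp add: \<tau>_def)
    finally have "norm_d d h < \<delta>" "norm_d d h < \<delta>'" using \<delta>(1) \<delta>'(1) by auto
    then have "\<bar>inner_d d g h - inner_d d g' h\<bar> \<le> 2 * e * norm_d d h"
      using \<delta>(2) [OF hR] \<delta>'(2) [OF hR] by linarith
    moreover have "inner_d d g h - inner_d d g' h = \<tau> * (norm_d d D)\<^sup>2"
      unfolding h_def norm_d_sq inner_d_scale_right
      by (simp add: D_def inner_d_linear algebra_simps)
    ultimately have "\<tau> * (norm_d d D)\<^sup>2 \<le> 2 * e * (\<tau> * norm_d d D)"
      unfolding nh by simp
    then show ?thesis using \<tau> pos by (simp add: power2_eq_square)
  qed
  \<comment> \<open>With \<open>e\<close> a quarter of the norm, the bound says that the norm is at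
    most half of itself.\<close>
  from this [of "norm_d d D / 4"] have "norm_d d D \<le> 0" by (cases "norm_d d D > 0") auto
  then have "inner_d d D D = 0"
    using norm_d_nonneg [of d D] norm_d_sq [of d D] by simp
  then have "D = (\<lambda>i. 0)" using DR inner_d_self_eq_0 by blast
  then show ?thesis by (auto simp: D_def fun_eq_iff)
qed

lemma has_grad_dI:
  assumes "g \<in> Rd d"
    and "\<And>h. h \<in> Rd d \<Longrightarrow> \<bar>f (\<lambda>i. x i + h i) - f x - inner_d d g h\<bar> \<le> B * (norm_d d h)\<^sup>2"
  shows "has_grad_d d f g x"
  unfolding has_grad_d_def
proof (intro conjI allI impI)
  fix e :: real assume e: "e > 0"
  show "\<exists>\<delta>>0. \<forall>h\<in>Rd d. norm_d d h < \<delta> \<longrightarrow>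
      \<bar>f (\<lambda>i. x i + h i) - f x - inner_d d g h\<bar> \<le> e * norm_d d h"
  proof (intro exI [of _ "e / (\<bar>B\<bar> + 1)"] conjI ballI impI)
    show "e / (\<bar>B\<bar> + 1) > 0" using e by simp
    fix h assume h: "h \<in> Rd d" and *: "norm_d d h < e / (\<bar>B\<bar> + 1)"
    have "norm_d d h * (\<bar>B\<bar> + 1) < e" using * by (simp add: pos_less_divide_eq)
    then have "B * norm_d d h \<le> e"
      using norm_d_nonneg [of d h] mult_right_mono [OF abs_ge_self [of B], of "norm_d d h"]
      by (simp add: algebra_simps)
    then have "B * (norm_d d h)\<^sup>2 \<le> e * norm_d d h"
      using mult_right_mono [of "B * norm_d d h" e "norm_d d h"] norm_d_nonneg [of d h]
      by (simp add: power2_eq_square mult.assoc)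
    then show "\<bar>f (\<lambda>i. x i + h i) - f x - inner_d d g h\<bar> \<le> e * norm_d d h"
      using assms(2) [OF h] by linarith
  qed
qed (rule assms)

lemma grad_d_eq:
  assumes "has_grad_d d f g x"
  shows "grad_d d f x = g"
  unfolding grad_d_def using assms has_grad_d_unique by (intro the_equality) blast+

text \<open>The quadratic proximal term turns the subgradient inequality at \<open>u\<close> into a
  surplus of \<open>|v - u|^2 / (2 \<gamma>)\<close> over the value at \<open>u\<close>. This gives
  minimality and also the uniqueness that the definite description in \<open>prox_d\<close>
  demands.\<close>

lemma prox_d_eq:
  assumes u: "u \<in> Rd d" and \<gamma>: "\<gamma> > 0"
    and subgrad: "\<And>v. v \<in> Rd d \<Longrightarrow> f v \<ge> f u + inner_d d g (\<lambda>i. v i - u i)"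
    and stat: "\<And>i. x i - u i = \<gamma> * g i"
  shows "prox_d d \<gamma> f x = u"
proof -
  have key: "f u + (norm_d d (\<lambda>i. x i - u i))\<^sup>2 / (2 * \<gamma>) + inner_d d (\<lambda>i. v i - u i) (\<lambda>i. v i - u i) / (2 * \<gamma>)
      \<le> f v + (norm_d d (\<lambda>i. x i - v i))\<^sup>2 / (2 * \<gamma>)" if v: "v \<in> Rd d" for v
  proof -
    let ?w = "\<lambda>i. v i - u i"
    have "(\<lambda>i. x i - v i) = (\<lambda>i. \<gamma> * g i - ?w i)"
      by (simp add: stat [symmetric])
    then have "(norm_d d (\<lambda>i. x i - v i))\<^sup>2 = inner_d d (\<lambda>i. \<gamma> * g i - ?w i) (\<lambda>i. \<gamma> * g i - ?w i)"
      by (simp only: norm_d_sq)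
    also have "\<dots> = inner_d d (\<lambda>i. \<gamma> * g i) (\<lambda>i. \<gamma> * g i) - 2 * \<gamma> * inner_d d g ?w + inner_d d ?w ?w"
      by (simp only: inner_d_diff_left [of d "\<lambda>i. \<gamma> * g i" ?w] inner_d_diff_right [of d _ "\<lambda>i. \<gamma> * g i" ?w]
          inner_d_scale_left inner_d_scale_right inner_d_commute [of d ?w g])
        (simp add: algebra_simps)
    also have "inner_d d (\<lambda>i. \<gamma> * g i) (\<lambda>i. \<gamma> * g i) = (norm_d d (\<lambda>i. x i - u i))\<^sup>2"
      by (simp add: norm_d_sq stat)
    finally have "(norm_d d (\<lambda>i. x i - v i))\<^sup>2 / (2 * \<gamma>) = (norm_d d (\<lambda>i. x i - u i))\<^sup>2 / (2 * \<gamma>)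
        - inner_d d g ?w + inner_d d ?w ?w / (2 * \<gamma>)"
      using \<gamma> by (simp add: field_simps)
    then show ?thesis using subgrad [OF v] by linarith
  qed
  show ?thesis unfolding prox_d_def
  proof (rule the_equality)
    show "u \<in> Rd d \<and> (\<forall>v\<in>Rd d. f u + (norm_d d (\<lambda>i. x i - u i))\<^sup>2 / (2 * \<gamma>)
        \<le> f v + (norm_d d (\<lambda>i. x i - v i))\<^sup>2 / (2 * \<gamma>))"
    proof (intro conjI ballI u)
      fix v assume "v \<in> Rd d"
      moreover have "inner_d d (\<lambda>i. v i - u i) (\<lambda>i. v i - u i) / (2 * \<gamma>) \<ge> 0"
        using \<gamma> inner_d_self_nonneg by simp
      ultimately show "f u + (norm_d d (\<lambda>i. x i - u i))\<^sup>2 / (2 * \<gamma>)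
          \<le> f v + (norm_d d (\<lambda>i. x i - v i))\<^sup>2 / (2 * \<gamma>)"
        using key [of v] by linarith
    qed
  next
    fix v assume v: "v \<in> Rd d \<and> (\<forall>w\<in>Rd d. f v + (norm_d d (\<lambda>i. x i - v i))\<^sup>2 / (2 * \<gamma>)
        \<le> f w + (norm_d d (\<lambda>i. x i - w i))\<^sup>2 / (2 * \<gamma>))"
    then have "inner_d d (\<lambda>i. v i - u i) (\<lambda>i. v i - u i) / (2 * \<gamma>) \<le> 0"
      using key [of v] u by fastforce
    then have "inner_d d (\<lambda>i. v i - u i) (\<lambda>i. v i - u i) = 0"
      using \<gamma> inner_d_self_nonneg [of d "\<lambda>i. v i - u i"] by (simp add: divide_le_0_iff)
    moreover have "(\<lambda>i. v i - u i) \<in> Rd d" using u v by (auto simp: Rd_def)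
    ultimately have "(\<lambda>i. v i - u i) = (\<lambda>i. 0)" using inner_d_self_eq_0 by blast
    then show "v = u" by (auto simp: fun_eq_iff)
  qed
qed

section \<open>Quadratics whose Hessian is a shifted symmetric contraction\<close>

definition sym_contraction :: "nat \<Rightarrow> (vecn \<Rightarrow> vecn) \<Rightarrow> bool" where
  "sym_contraction d T \<longleftrightarrow>
     (\<forall>x\<in>Rd d. T x \<in> Rd d) \<and>
     (\<forall>c x y. T (\<lambda>i. x i + c * y i) = (\<lambda>i. T x i + c * T y i)) \<and>
     (\<forall>x\<in>Rd d. \<forall>y\<in>Rd d. inner_d d x (T y) = inner_d d (T x) y) \<and>
     (\<forall>x\<in>Rd d. inner_d d (T x) (T x) \<le> inner_d d x x)"

lemma sym_contractionD:
  assumes "sym_contraction d T"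
  shows "x \<in> Rd d \<Longrightarrow> T x \<in> Rd d"
    and "T (\<lambda>i. x i + c * y i) = (\<lambda>i. T x i + c * T y i)"
    and "T (\<lambda>i. x i + y i) = (\<lambda>i. T x i + T y i)"
    and "T (\<lambda>i. x i - y i) = (\<lambda>i. T x i - T y i)"
    and "x \<in> Rd d \<Longrightarrow> y \<in> Rd d \<Longrightarrow> inner_d d x (T y) = inner_d d (T x) y"
    and "x \<in> Rd d \<Longrightarrow> inner_d d (T x) (T x) \<le> inner_d d x x"
proof -
  have lin: "T (\<lambda>i. x i + c * y i) = (\<lambda>i. T x i + c * T y i)" for x y c
    using assms by (simp add: sym_contraction_def)
  show "T (\<lambda>i. x i + c * y i) = (\<lambda>i. T x i + c * T y i)" by (rule lin)
  show "T (\<lambda>i. x i + y i) = (\<lambda>i. T x i + T y i)" using lin [of x 1 y] by simp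
  show "T (\<lambda>i. x i - y i) = (\<lambda>i. T x i - T y i)" using lin [of x "-1" y] by simp
qed (use assms in \<open>auto simp: sym_contraction_def\<close>)

text \<open>The Hessian \<open>(\<mu> + \<nu>) I - \<nu> T\<close> has its spectrum in
  \<open>[\<mu>, \<mu> + 2 \<nu>]\<close> for every symmetric contraction \<open>T\<close>, so
  smoothness and strong convexity come for free once \<open>T\<close> is one.\<close>

definition quad :: "nat \<Rightarrow> real \<Rightarrow> real \<Rightarrow> (vecn \<Rightarrow> vecn) \<Rightarrow> vecn \<Rightarrow> vecn \<Rightarrow> real" where
  "quad d \<mu> \<nu> T b x =
     (\<mu> + \<nu>) / 2 * inner_d d x x - \<nu> / 2 * inner_d d x (T x) - inner_d d b x"

definition quad_grad :: "real \<Rightarrow> real \<Rightarrow> (vecn \<Rightarrow> vecn) \<Rightarrow> vecn \<Rightarrow> vecn \<Rightarrow> vecn" where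
  "quad_grad \<mu> \<nu> T b x = (\<lambda>i. (\<mu> + \<nu>) * x i - \<nu> * T x i - b i)"

lemma quad_expand:
  assumes T: "sym_contraction d T" and x: "x \<in> Rd d" and h: "h \<in> Rd d"
  shows "quad d \<mu> \<nu> T b (\<lambda>i. x i + h i) = quad d \<mu> \<nu> T b x + inner_d d (quad_grad \<mu> \<nu> T b x) h
     + ((\<mu> + \<nu>) / 2 * inner_d d h h - \<nu> / 2 * inner_d d h (T h))"
proof -
  have "inner_d d x (T h) = inner_d d (T x) h" using sym_contractionD(5) [OF T x h] .
  moreover have "inner_d d h (T x) = inner_d d (T x) h" by (rule inner_d_commute)
  moreover have "inner_d d h x = inner_d d x h" by (rule inner_d_commute)
  ultimately show ?thesis
    by (simp add: quad_def quad_grad_def sym_contractionD(3) [OF T] inner_d_linear field_simps)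
qed

lemma quad_remainder_bounds:
  assumes T: "sym_contraction d T" and h: "h \<in> Rd d" and "\<nu> \<ge> 0"
  shows "\<mu> / 2 * inner_d d h h \<le> (\<mu> + \<nu>) / 2 * inner_d d h h - \<nu> / 2 * inner_d d h (T h)"
    and "(\<mu> + \<nu>) / 2 * inner_d d h h - \<nu> / 2 * inner_d d h (T h) \<le> (\<mu> / 2 + \<nu>) * inner_d d h h"
proof -
  have "\<bar>inner_d d h (T h)\<bar> \<le> inner_d d h h"
    using sym_contractionD(6) [OF T h] by (rule inner_d_le_of_contraction)
  then have "\<nu> * \<bar>inner_d d h (T h)\<bar> \<le> \<nu> * inner_d d h h"
    using \<open>\<nu> \<ge> 0\<close> by (rule mult_left_mono)
  then have "\<bar>\<nu> * inner_d d h (T h)\<bar> \<le> \<nu> * inner_d d h h"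
    using \<open>\<nu> \<ge> 0\<close> by (simp add: abs_mult)
  then have "\<nu> * inner_d d h (T h) \<le> \<nu> * inner_d d h h"
    and "- (\<nu> * inner_d d h (T h)) \<le> \<nu> * inner_d d h h" by linarith+
  then show "\<mu> / 2 * inner_d d h h \<le> (\<mu> + \<nu>) / 2 * inner_d d h h - \<nu> / 2 * inner_d d h (T h)"
    and "(\<mu> + \<nu>) / 2 * inner_d d h h - \<nu> / 2 * inner_d d h (T h) \<le> (\<mu> / 2 + \<nu>) * inner_d d h h"
    by (simp_all add: field_simps)
qed

lemma quad_has_grad:
  assumes T: "sym_contraction d T" and x: "x \<in> Rd d" and b: "b \<in> Rd d" and "\<mu> \<ge> 0" "\<nu> \<ge> 0"
  shows "has_grad_d d (quad d \<mu> \<nu> T b) (quad_grad \<mu> \<nu> T b x) x"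
proof (rule has_grad_dI)
  show "quad_grad \<mu> \<nu> T b x \<in> Rd d"
    using x b sym_contractionD(1) [OF T x] by (auto simp: quad_grad_def Rd_def)
  fix h assume h: "h \<in> Rd d"
  have "0 \<le> \<mu> / 2 * inner_d d h h" using \<open>\<mu> \<ge> 0\<close> inner_d_self_nonneg by simp
  then show "\<bar>quad d \<mu> \<nu> T b (\<lambda>i. x i + h i) - quad d \<mu> \<nu> T b x - inner_d d (quad_grad \<mu> \<nu> T b x) h\<bar>
      \<le> (\<mu> / 2 + \<nu>) * (norm_d d h)\<^sup>2"
    using quad_expand [OF T x h, of \<mu> \<nu> b] quad_remainder_bounds [OF T h \<open>\<nu> \<ge> 0\<close>, of \<mu>]
    unfolding norm_d_sq by linarith
qed

lemma quad_above_tangent: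
  assumes T: "sym_contraction d T" and x: "x \<in> Rd d" and y: "y \<in> Rd d" and "\<nu> \<ge> 0"
  shows "quad d \<mu> \<nu> T b y \<ge> quad d \<mu> \<nu> T b x + inner_d d (quad_grad \<mu> \<nu> T b x) (\<lambda>i. y i - x i)
     + \<mu> / 2 * (norm_d d (\<lambda>i. y i - x i))\<^sup>2"
proof -
  have h: "(\<lambda>i. y i - x i) \<in> Rd d" using x y by (auto simp: Rd_def)
  show ?thesis
    using quad_expand [OF T x h, of \<mu> \<nu> b] quad_remainder_bounds(1) [OF T h \<open>\<nu> \<ge> 0\<close>, of \<mu>]
    by (simp add: norm_d_sq)
qed

lemma quad_strongly_convex:
  assumes "sym_contraction d T" "b \<in> Rd d" "\<mu> \<ge> 0" "\<nu> \<ge> 0"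
  shows "strongly_convex d \<mu> (quad d \<mu> \<nu> T b)"
  unfolding strongly_convex_def differentiable_d_def
proof (intro conjI ballI)
  fix x assume x: "x \<in> Rd d"
  note g = quad_has_grad [OF assms(1) x assms(2-4)]
  then show "\<exists>g. has_grad_d d (quad d \<mu> \<nu> T b) g x" by blast
  fix y assume y: "y \<in> Rd d"
  show "quad d \<mu> \<nu> T b x + inner_d d (grad_d d (quad d \<mu> \<nu> T b) x) (\<lambda>i. y i - x i)
      + \<mu> / 2 * (norm_d d (\<lambda>i. y i - x i))\<^sup>2 \<le> quad d \<mu> \<nu> T b y"
    unfolding grad_d_eq [OF g] by (rule quad_above_tangent [OF assms(1) x y assms(4)])
qed

text \<open>No eigenvalues are used: in the expansion of
  \<open>|(\<mu> + \<nu>) z - \<nu> T z|^2\<close> both \<open>- <z, T z>\<close> and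
  \<open>|T z|^2\<close> are at most \<open>|z|^2\<close>, and the coefficients add up to
  \<open>(\<mu> + 2 \<nu>)^2\<close>.\<close>

lemma quad_L_smooth:
  assumes T: "sym_contraction d T" and b: "b \<in> Rd d" and "\<mu> \<ge> 0" "\<nu> \<ge> 0"
  shows "L_smooth d (\<mu> + 2 * \<nu>) (quad d \<mu> \<nu> T b)"
  unfolding L_smooth_def differentiable_d_def
proof (intro conjI ballI)
  fix x assume x: "x \<in> Rd d"
  show "\<exists>g. has_grad_d d (quad d \<mu> \<nu> T b) g x" using quad_has_grad [OF T x b] assms by blast
  fix y assume y: "y \<in> Rd d"
  define z where "z = (\<lambda>i. x i - y i)"
  have z: "z \<in> Rd d" using x y by (auto simp: Rd_def z_def)
  have "(\<lambda>i. grad_d d (quad d \<mu> \<nu> T b) x i - grad_d d (quad d \<mu> \<nu> T b) y i)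
      = (\<lambda>i. (\<mu> + \<nu>) * z i - \<nu> * T z i)"
    using grad_d_eq [OF quad_has_grad [OF T x b]] grad_d_eq [OF quad_has_grad [OF T y b]] assms
    by (simp add: quad_grad_def z_def sym_contractionD(4) [OF T] algebra_simps)
  then have "norm_d d (\<lambda>i. grad_d d (quad d \<mu> \<nu> T b) x i - grad_d d (quad d \<mu> \<nu> T b) y i)
      = sqrt (inner_d d (\<lambda>i. (\<mu> + \<nu>) * z i - \<nu> * T z i) (\<lambda>i. (\<mu> + \<nu>) * z i - \<nu> * T z i))"
    by (simp add: norm_d_eq_sqrt)
  also have "inner_d d (\<lambda>i. (\<mu> + \<nu>) * z i - \<nu> * T z i) (\<lambda>i. (\<mu> + \<nu>) * z i - \<nu> * T z i)
     = (\<mu> + \<nu>)\<^sup>2 * inner_d d z z - 2 * (\<mu> + \<nu>) * \<nu> * inner_d d z (T z)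
        + \<nu>\<^sup>2 * inner_d d (T z) (T z)"
    by (simp add: inner_d_linear inner_d_commute [of d "T z" z] power2_eq_square algebra_simps)
  also have "\<dots> \<le> (\<mu> + 2 * \<nu>)\<^sup>2 * inner_d d z z"
  proof -
    have c: "inner_d d (T z) (T z) \<le> inner_d d z z" using sym_contractionD(6) [OF T z] .
    have "- inner_d d z (T z) \<le> inner_d d z z"
      using inner_d_le_of_contraction [OF c] by linarith
    then have "2 * (\<mu> + \<nu>) * \<nu> * (- inner_d d z (T z)) \<le> 2 * (\<mu> + \<nu>) * \<nu> * inner_d d z z"
      using assms by (intro mult_left_mono) auto
    moreover have "\<nu>\<^sup>2 * inner_d d (T z) (T z) \<le> \<nu>\<^sup>2 * inner_d d z z"
      using c by (intro mult_left_mono) auto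
    ultimately show ?thesis by (simp add: power2_eq_square algebra_simps)
  qed
  finally show "norm_d d (\<lambda>i. grad_d d (quad d \<mu> \<nu> T b) x i - grad_d d (quad d \<mu> \<nu> T b) y i)
      \<le> (\<mu> + 2 * \<nu>) * norm_d d (\<lambda>i. x i - y i)"
    using assms by (simp add: norm_d_eq_sqrt z_def [symmetric] real_sqrt_mult)
qed

section \<open>Householder reflections and weighted involutions of the coordinates\<close>

definition reflect :: "nat \<Rightarrow> vecn \<Rightarrow> vecn \<Rightarrow> vecn" where
  "reflect d w x = (\<lambda>j. x j - 2 * inner_d d w x / inner_d d w w * w j)"

lemma reflect_in_Rd: "w \<in> Rd d \<Longrightarrow> x \<in> Rd d \<Longrightarrow> reflect d w x \<in> Rd d"
  by (auto simp: reflect_def Rd_def)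

lemma reflect_linear:
  "reflect d w (\<lambda>i. x i + c * y i) = (\<lambda>i. reflect d w x i + c * reflect d w y i)"
  by (simp add: reflect_def inner_d_linear add_divide_distrib algebra_simps)

lemma reflect_diff: "reflect d w (\<lambda>i. x i - y i) = (\<lambda>i. reflect d w x i - reflect d w y i)"
  using reflect_linear [of d w x "-1" y] by simp

lemma reflect_scale: "reflect d w (\<lambda>i. c * x i) = (\<lambda>i. c * reflect d w x i)"
  by (simp add: reflect_def inner_d_scale_right algebra_simps)

lemma reflect_sum:
  "reflect d w (\<lambda>k. \<Sum>j<N. c j * v j k) = (\<lambda>k. \<Sum>j<(N::nat). c j * reflect d w (v j) k)"
proof (induction N)
  case 0
  then show ?case by (simp add: reflect_def inner_d_def)
next
  case (Suc N)
  then show ?case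
    using reflect_linear [of d w "\<lambda>k. \<Sum>j<N. c j * v j k" "c N" "v N"] by simp
qed

lemma inner_d_reflect_left: "inner_d d (reflect d w x) y = inner_d d x (reflect d w y)"
  unfolding reflect_def inner_d_diff_left inner_d_diff_right inner_d_scale_left inner_d_scale_right
  by (simp add: inner_d_commute [of d x w])

lemma reflect_reflect: "reflect d w (reflect d w x) = x"
proof (cases "inner_d d w w = 0")
  case True
  then show ?thesis by (simp add: reflect_def)
next
  case False
  then have "inner_d d w (reflect d w x) = - inner_d d w x"
    unfolding reflect_def inner_d_diff_right inner_d_scale_right by simp
  then show ?thesis by (simp add: reflect_def [of d w "reflect d w x"]) (simp add: reflect_def)
qed

lemma inner_d_reflect: "inner_d d (reflect d w x) (reflect d w y) = inner_d d x y"
  by (simp add: inner_d_reflect_left reflect_reflect)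

definition axis :: "nat \<Rightarrow> real \<Rightarrow> vecn" where
  "axis k c = (\<lambda>j. if j = k then c else 0)"

lemma inner_d_axis: "k < d \<Longrightarrow> inner_d d x (axis k c) = c * x k"
  by (simp add: inner_d_def axis_def if_distrib [of "times _"] mult.commute cong: if_cong)

lemma inner_d_axis_left: "k < d \<Longrightarrow> inner_d d (axis k c) x = c * x k"
  by (simp add: inner_d_axis inner_d_commute [of d "axis k c" x])

text \<open>\<open>x\<close> and its target have equal norms, hence their difference
  \<open>w\<close> satisfies \<open><w, w> = 2 <w, x>\<close> and the reflection subtracts exactly
  \<open>w\<close>.\<close>

lemma reflect_to_axis:
  assumes x: "x \<in> Rd d" and k: "k < d"
  shows "reflect d (\<lambda>j. x j - axis k (norm_d d x) j) x = axis k (norm_d d x)"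
proof -
  let ?r = "norm_d d x"
  define w where "w = (\<lambda>j. x j - axis k ?r j)"
  have wR: "w \<in> Rd d" using x k by (auto simp: w_def axis_def Rd_def)
  have xx: "inner_d d x x = ?r\<^sup>2" by (simp add: norm_d_sq)
  have wx: "inner_d d w x = ?r\<^sup>2 - ?r * x k"
    using k by (simp add: w_def inner_d_linear inner_d_axis inner_d_axis_left xx)
  moreover have "inner_d d (axis k ?r) (axis k ?r) = ?r\<^sup>2"
    using k by (simp add: inner_d_axis) (simp add: axis_def power2_eq_square)
  ultimately have ww: "inner_d d w w = 2 * inner_d d w x"
    using k by (simp add: w_def inner_d_linear inner_d_axis inner_d_axis_left xx)
  show ?thesis
  proof (cases "inner_d d w w = 0")
    \<comment> \<open>Here \<open>x\<close> already equals the target. Division by zero yields zero,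
      so \<open>reflect\<close> is the identity.\<close>
    case True
    then have "w = (\<lambda>i. 0)" using wR inner_d_self_eq_0 by blast
    then have "\<And>i. x i = axis k ?r i" by (auto simp: w_def fun_eq_iff)
    then show ?thesis unfolding w_def [symmetric] using True by (auto simp: reflect_def)
  next
    case False
    then have "reflect d w x = (\<lambda>j. x j - w j)" using ww by (simp add: reflect_def)
    then show ?thesis by (simp add: w_def)
  qed
qed

definition wswap :: "(nat \<Rightarrow> real) \<Rightarrow> (nat \<Rightarrow> nat) \<Rightarrow> vecn \<Rightarrow> vecn" where
  "wswap s \<sigma> x = (\<lambda>j. s j * x (\<sigma> j))"

text \<open>Symmetry is reindexing along the involution, which preserves the weights; the norm bound
  is the same reindexing after the weights are dropped.\<close>

lemma wswap_sym_contraction: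
  assumes inv: "\<And>j. \<sigma> (\<sigma> j) = j" and bd: "\<And>j. j < d \<Longrightarrow> \<sigma> j < d"
    and s: "\<And>j. s (\<sigma> j) = s j" and s1: "\<And>j. \<bar>s j\<bar> \<le> 1"
  shows "sym_contraction d (wswap s \<sigma>)"
  unfolding sym_contraction_def
proof (intro conjI ballI allI)
  have bd': "d \<le> \<sigma> j" if "d \<le> j" for j
    using bd [of "\<sigma> j"] inv [of j] that by force
  fix x assume x: "x \<in> Rd d"
  show "wswap s \<sigma> x \<in> Rd d" using x bd' by (auto simp: wswap_def Rd_def)
  have "inner_d d (wswap s \<sigma> x) (wswap s \<sigma> x) = (\<Sum>j<d. (s j * x (\<sigma> j))\<^sup>2)"
    by (simp add: inner_d_def wswap_def power2_eq_square)
  also have "\<dots> \<le> (\<Sum>j<d. (x (\<sigma> j))\<^sup>2)"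
  proof (rule sum_mono)
    fix j
    have "(s j)\<^sup>2 \<le> 1" using s1 [of j] by (simp add: abs_square_le_1)
    then show "(s j * x (\<sigma> j))\<^sup>2 \<le> (x (\<sigma> j))\<^sup>2"
      by (simp add: power_mult_distrib mult_left_le_one_le)
  qed
  also have "\<dots> = (\<Sum>j<d. (x j)\<^sup>2)"
    by (rule sum.reindex_bij_witness [where i = \<sigma> and j = \<sigma>]) (auto simp: inv bd)
  finally show "inner_d d (wswap s \<sigma> x) (wswap s \<sigma> x) \<le> inner_d d x x"
    by (simp add: inner_d_def power2_eq_square)
  fix y
  show "inner_d d x (wswap s \<sigma> y) = inner_d d (wswap s \<sigma> x) y"
    unfolding inner_d_def wswap_def
    by (rule sum.reindex_bij_witness [where i = \<sigma> and j = \<sigma>]) (auto simp: inv bd s)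
qed (simp add: wswap_def algebra_simps)

lemma reflect_conj_sym_contraction:
  assumes T: "sym_contraction d T" and w: "w \<in> Rd d"
  shows "sym_contraction d (\<lambda>x. reflect d w (T (reflect d w x)))"
  unfolding sym_contraction_def
proof (intro conjI ballI allI)
  show "reflect d w (T (reflect d w (\<lambda>i. x i + c * y i)))
      = (\<lambda>i. reflect d w (T (reflect d w x)) i + c * reflect d w (T (reflect d w y)) i)" for c x y
    by (simp only: reflect_linear sym_contractionD(2) [OF T])
  fix x assume x: "x \<in> Rd d"
  then have Rx: "reflect d w x \<in> Rd d" by (rule reflect_in_Rd [OF w])
  show "reflect d w (T (reflect d w x)) \<in> Rd d"
    using sym_contractionD(1) [OF T Rx] by (rule reflect_in_Rd [OF w])
  show "inner_d d (reflect d w (T (reflect d w x))) (reflect d w (T (reflect d w x))) \<le> inner_d d x x"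
    using sym_contractionD(6) [OF T Rx] by (simp only: inner_d_reflect)
  fix y assume "y \<in> Rd d"
  then have "reflect d w y \<in> Rd d" by (rule reflect_in_Rd [OF w])
  then show "inner_d d x (reflect d w (T (reflect d w y))) = inner_d d (reflect d w (T (reflect d w x))) y"
    using sym_contractionD(5) [OF T Rx]
    by (simp only: inner_d_reflect_left inner_d_reflect_left [symmetric, of d w x])
qed

section \<open>Expected progress\<close>

text \<open>\<open>l k\<close> is the index whose draw unlocks coordinate \<open>k\<close>. The
  count depends on the draws alone, whatever the algorithm does with the answers.\<close>

primrec progress :: "(nat \<Rightarrow> nat) \<Rightarrow> (nat \<Rightarrow> nat) \<Rightarrow> nat \<Rightarrow> nat" where
  "progress l is 0 = 0"
| "progress l is (Suc t) =
     (if is t = l (progress l is t) then Suc (progress l is t) else progress l is t)"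

lemma progress_cong: "(\<And>k. k < t \<Longrightarrow> is k = js k) \<Longrightarrow> progress l is t = progress l js t"
  by (induction t) auto

lemma progress_mono: "s \<le> t \<Longrightarrow> progress l is s \<le> progress l is t"
  by (rule lift_Suc_mono_le) auto

lemma sum_PiE_Suc:
  "(\<Sum>is\<in>PiE {..<Suc t} (\<lambda>_. S). F is) = (\<Sum>is\<in>PiE {..<t} (\<lambda>_. S). \<Sum>j\<in>S. F (is(t := j)))"
proof -
  have "(\<Sum>is\<in>PiE {..<Suc t} (\<lambda>_. S). F is)
      = (\<Sum>(j, is)\<in>S \<times> PiE {..<t} (\<lambda>_. S). F (is(t := j)))"
    unfolding lessThan_Suc PiE_insert_eq
    by (subst sum.reindex) (auto intro!: inj_combinator sum.cong)
  also have "\<dots> = (\<Sum>j\<in>S. \<Sum>is\<in>PiE {..<t} (\<lambda>_. S). F (is(t := j)))"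
    by (rule sum.cartesian_product [symmetric])
  also have "\<dots> = (\<Sum>is\<in>PiE {..<t} (\<lambda>_. S). \<Sum>j\<in>S. F (is(t := j)))"
    by (rule sum.swap)
  finally show ?thesis .
qed

lemma sum_prod_weights_eq_1:
  fixes p :: "nat \<Rightarrow> real" and t :: nat
  assumes "(\<Sum>j<n. p j) = 1"
  shows "(\<Sum>is\<in>PiE {..<t} (\<lambda>_. {..<n}). \<Prod>k<t. p (is k)) = 1"
proof (induction t)
  case (Suc t)
  have "(\<Prod>k<t. p ((is(t := j)) k)) = (\<Prod>k<t. p (is k))" for "is" :: "nat \<Rightarrow> nat" and j
    by (rule prod.cong) auto
  then show ?case
    using Suc assms by (simp add: sum_PiE_Suc sum_distrib_left [symmetric])
qed simp

text \<open>Given the first \<open>t\<close> draws, the count \<open>k\<close> grows with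
  probability \<open>p (l k)\<close>, which multiplies the conditional expectation of the power by
  \<open>1 - p (l k) * (1 - r)\<close>. The last hypothesis keeps the lower bound of this factor
  nonnegative, so that the induction hypothesis can be multiplied by it.\<close>

lemma expected_power_progress_ge:
  fixes p :: "nat \<Rightarrow> real"
  assumes p: "\<And>j. j < n \<Longrightarrow> p j \<ge> 0" and sum: "(\<Sum>j<n. p j) = 1"
    and l: "\<And>k. l k < n" "\<And>k. p (l k) \<le> \<theta>"
    and r: "0 \<le> r" "r \<le> 1" and \<theta>: "\<theta> * (1 - r) \<le> 1"
  shows "(1 - \<theta> * (1 - r)) ^ t
    \<le> (\<Sum>is\<in>PiE {..<t} (\<lambda>_. {..<n}). (\<Prod>k<t. p (is k)) * r ^ progress l is t)"
proof (induction t)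
  case (Suc t)
  let ?P = "PiE {..<t} (\<lambda>_. {..<n})"
  have step: "(\<Prod>k<t. p (is k)) * r ^ progress l is t * (1 - \<theta> * (1 - r))
     \<le> (\<Sum>j<n. (\<Prod>k<Suc t. p ((is(t := j)) k)) * r ^ progress l (is(t := j)) (Suc t))"
    if "is \<in> ?P" for "is"
  proof -
    let ?k = "progress l is t"
    let ?w = "\<Prod>k<t. p (is k)"
    have w: "?w \<ge> 0" using that p by (intro prod_nonneg) (auto simp: PiE_iff)
    have pr: "progress l (is(t := j)) t = ?k" for j by (rule progress_cong) auto
    have "(\<Prod>k<t. p ((is(t := j)) k)) = ?w" for j by (rule prod.cong) auto
    then have "(\<Sum>j<n. (\<Prod>k<Suc t. p ((is(t := j)) k)) * r ^ progress l (is(t := j)) (Suc t))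
      = (\<Sum>j<n. ?w * r ^ ?k * (p j - (if j = l ?k then p j * (1 - r) else 0)))"
      by (intro sum.cong) (simp_all add: pr algebra_simps)
    also have "\<dots> = ?w * r ^ ?k * (1 - p (l ?k) * (1 - r))"
      by (simp add: sum_distrib_left [symmetric] sum_subtractf sum l)
    finally have eq: "(\<Sum>j<n. (\<Prod>k<Suc t. p ((is(t := j)) k)) * r ^ progress l (is(t := j)) (Suc t))
      = ?w * r ^ ?k * (1 - p (l ?k) * (1 - r))" .
    have "p (l ?k) * (1 - r) \<le> \<theta> * (1 - r)" using l(2) r by (intro mult_right_mono) auto
    then show ?thesis
      unfolding eq using w r by (intro mult_left_mono) auto
  qed
  have "(1 - \<theta> * (1 - r)) ^ Suc t = (1 - \<theta> * (1 - r)) ^ t * (1 - \<theta> * (1 - r))" by simp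
  also have "\<dots> \<le> (\<Sum>is\<in>?P. (\<Prod>k<t. p (is k)) * r ^ progress l is t) * (1 - \<theta> * (1 - r))"
    using Suc.IH \<theta> by (intro mult_right_mono) auto
  also have "\<dots> \<le> (\<Sum>is\<in>?P. \<Sum>j<n. (\<Prod>k<Suc t. p ((is(t := j)) k)) * r ^ progress l (is(t := j)) (Suc t))"
    unfolding sum_distrib_right by (intro sum_mono step)
  finally show ?case by (simp only: sum_PiE_Suc)
qed simp

text \<open>Otherwise at least \<open>n - 1\<close> indices exceed \<open>2 / n\<close>, for a total
  above \<open>2 (n - 1) / n\<close>, which is at least 1.\<close>

lemma two_improbable_indices:
  fixes p :: "nat \<Rightarrow> real"
  assumes n: "n \<ge> 2" and p: "\<And>j. j < n \<Longrightarrow> p j \<ge> 0" and sum: "(\<Sum>j<n. p j) = 1"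
  obtains a b where "a < n" "b < n" "a \<noteq> b" "p a \<le> 2 / n" "p b \<le> 2 / n"
proof -
  define S where "S = {j. j < n \<and> p j > 2 / n}"
  define S' where "S' = {j. j < n \<and> p j \<le> 2 / n}"
  have fin: "finite S" "finite S'" by (auto simp: S_def S'_def)
  have "S \<union> S' = {..<n}" "S \<inter> S' = {}" by (auto simp: S_def S'_def)
  then have card: "card S + card S' = n"
    using card_Un_disjoint [OF fin] by simp
  have "card S' \<ge> 2"
  proof (rule ccontr)
    assume "\<not> card S' \<ge> 2"
    then have big: "card S \<ge> n - 1" using card by simp
    then have "S \<noteq> {}" using n by auto
    then have "(\<Sum>j\<in>S. 2 / real n) < (\<Sum>j\<in>S. p j)"
      using fin by (intro sum_strict_mono) (auto simp: S_def)
    also have "\<dots> \<le> (\<Sum>j<n. p j)"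
      using p by (intro sum_mono2) (auto simp: S_def)
    finally have "real (card S) * 2 < n" using n by (simp add: sum field_simps)
    then show False using big n by linarith
  qed
  then have "\<not> (\<forall>x\<in>S'. \<forall>y\<in>S'. x = y)"
    using card_le_Suc0_iff_eq [OF fin(2)] by auto
  then show thesis using that by (auto simp: S'_def)
qed

section \<open>Histories of oracle answers\<close>

lemma length_hist: "length (hist A gam d fs is t) = t"
  by (induction t) (auto simp: Let_def)

lemma take_hist: "s \<le> t \<Longrightarrow> take s (hist A gam d fs is t) = hist A gam d fs is s"
proof (induction t)
  case (Suc t)
  then show ?case
    by (cases "s = Suc t") (auto simp: Let_def length_hist)
qed simp

lemma hist_nth:
  "s < t \<Longrightarrow> hist A gam d fs is t ! s = (is s, fs (is s) (iterate A gam d fs is s),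
     grad_d d (fs (is s)) (iterate A gam d fs is s),
     prox_d d (gam (Suc s)) (fs (is s)) (iterate A gam d fs is s))"
proof (induction t)
  case (Suc t)
  then show ?case
    by (cases "s = t") (auto simp: Let_def nth_append length_hist iterate_def)
qed simp

section \<open>The chain instance\<close>

text \<open>Summation by parts for the path Laplacian: after an index shift the two contributions of
  each link complete a square, and the free end leaves the boundary term.\<close>

lemma sum_chain_by_parts:
  fixes z :: vecn
  shows "(\<Sum>j<Suc M. z j * ((if 0 < j then z j - z (j - 1) else 0) + (z j - (if j < M then z (Suc j) else q * z j))))
    = (\<Sum>j<M. (z j - z (Suc j))\<^sup>2) + (1 - q) * (z M)\<^sup>2"
proof -
  have "(\<Sum>j<Suc M. z j * (if 0 < j then z j - z (j - 1) else 0)) = (\<Sum>j<M. z (Suc j) * (z (Suc j) - z j))"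
    by (simp only: sum.lessThan_Suc_shift) simp
  moreover have "(\<Sum>j<Suc M. z j * (z j - (if j < M then z (Suc j) else q * z j)))
      = (\<Sum>j<M. z j * (z j - z (Suc j))) + (1 - q) * (z M)\<^sup>2"
    by (simp add: power2_eq_square algebra_simps)
  moreover have "(\<Sum>j<M. z (Suc j) * (z (Suc j) - z j)) + (\<Sum>j<M. z j * (z j - z (Suc j)))
      = (\<Sum>j<M. (z j - z (Suc j))\<^sup>2)"
    unfolding sum.distrib [symmetric] by (rule sum.cong) (simp_all add: power2_eq_square algebra_simps)
  ultimately show ?thesis
    by (simp only: distrib_left sum.distrib)
qed

text \<open>Coordinates 0 to \<open>M\<close> carry the chain, coordinate \<open>M + 1\<close> the
  reflected initial point. \<open>balance\<close> is the characteristic equation of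
  \<open>n \<mu> y_j + \<nu> (2 y_j - y_(j-1) - y_(j+1)) = 0\<close> for \<open>y_j = q^j\<close>,
  and \<open>W\<close> is the amplitude of the minimizer.\<close>

locale chain =
  fixes n a b M :: nat and q \<mu> \<nu> W :: real and x0 :: vecn
  assumes a: "a < n" and b: "b < n" and ab: "a \<noteq> b"
    and q0: "0 < q" and q1: "q < 1" and \<mu>: "\<mu> > 0" and \<nu>: "\<nu> > 0"
    and balance: "real n * \<mu> * q = \<nu> * (1 - q)\<^sup>2"
    and x0: "x0 \<in> Rd (Suc (Suc M))"
begin

text \<open>\<open>link l\<close> owns the link between coordinates \<open>l - 1\<close> and
  \<open>l\<close>; \<open>link 0\<close> owns the linear term at coordinate 0 and
  \<open>link (Suc M)\<close> the boundary term at the free end.\<close>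

definition link :: "nat \<Rightarrow> nat" where
  "link l = (if even l then a else b)"

text \<open>Exchanges the two ends of each link of component \<open>i\<close>; the owners alternate,
  so these pairs are disjoint. A swapped pair contributes the square of its difference to
  \<open><y, y - S i y>\<close>, which makes a chain component a \<open>quad\<close>.\<close>

definition partner :: "nat \<Rightarrow> nat \<Rightarrow> nat" where
  "partner i j = (if 0 < j \<and> j \<le> M \<and> link j = i then j - 1
     else if j < M \<and> link (Suc j) = i then Suc j else j)"

text \<open>The weight \<open>q\<close> at the free end makes the geometric sequence an exact stationary point.\<close>

definition weight :: "nat \<Rightarrow> nat \<Rightarrow> real" where
  "weight i j = (if j = M \<and> link (Suc M) = i then q else 1)"

abbreviation dim :: nat where "dim \<equiv> Suc (Suc M)"

definition R :: "vecn \<Rightarrow> vecn" where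
  "R = reflect dim (\<lambda>j. x0 j - axis (Suc M) (norm_d dim x0) j)"

definition S :: "nat \<Rightarrow> vecn \<Rightarrow> vecn" where
  "S i = wswap (weight i) (partner i)"

text \<open>The entry at coordinate 0 is the one that stationarity of the geometric sequence
  demands. The entry at \<open>M + 1\<close>, shared by all components, makes the initial point
  optimal in that coordinate.\<close>

definition lin :: "nat \<Rightarrow> vecn" where
  "lin i = (\<lambda>j. if j = 0 \<and> i = a then \<nu> * W * (1 - q) / q
     else if j = Suc M then \<mu> * norm_d dim x0 else 0)"

text \<open>Conjugation by the orthogonal involution \<open>R\<close> gives the chain quadratic
  evaluated at \<open>R x\<close>.\<close>

definition comp :: "nat \<Rightarrow> vecn \<Rightarrow> real" where
  "comp i = quad dim \<mu> \<nu> (\<lambda>x. R (S i (R x))) (R (lin i))"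

lemma link_less: "link l < n"
  using a b by (simp add: link_def)

lemma link_Suc_neq: "link (Suc l) \<noteq> link l"
  using ab by (simp add: link_def)

lemma partner_partner: "partner i (partner i j) = j"
proof (cases "0 < j \<and> j \<le> M \<and> link j = i")
  case True
  then obtain j' where j': "j = Suc j'" by (cases j) auto
  then show ?thesis using True link_Suc_neq [of j'] by (auto simp: partner_def)
next
  case False
  then show ?thesis by (auto simp: partner_def)
qed

lemma weight_partner: "weight i (partner i j) = weight i j"
  using link_Suc_neq [of M] by (auto simp: partner_def weight_def)

lemma S_sym_contraction: "sym_contraction dim (S i)"
  unfolding S_def
  by (rule wswap_sym_contraction)
     (use q0 q1 in \<open>auto simp: partner_partner weight_partner\<close>, auto simp: partner_def weight_def)

lemma R_vec: "(\<lambda>j. x0 j - axis (Suc M) (norm_d dim x0) j) \<in> Rd dim"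
  using x0 by (auto simp: axis_def Rd_def)

lemma R_in_Rd: "x \<in> Rd dim \<Longrightarrow> R x \<in> Rd dim"
  unfolding R_def by (rule reflect_in_Rd [OF R_vec])

lemma R_R: "R (R x) = x"
  unfolding R_def by (rule reflect_reflect)

lemma R_x0: "R x0 = axis (Suc M) (norm_d dim x0)"
  unfolding R_def by (rule reflect_to_axis [OF x0]) simp

lemma R_diff: "R (\<lambda>i. x i - y i) = (\<lambda>i. R x i - R y i)"
  unfolding R_def by (rule reflect_diff)

lemma R_scale: "R (\<lambda>i. c * x i) = (\<lambda>i. c * R x i)"
  unfolding R_def by (rule reflect_scale)

lemma inner_d_R: "inner_d dim (R x) y = inner_d dim x (R y)"
  unfolding R_def by (rule inner_d_reflect_left)

lemma T_sym_contraction: "sym_contraction dim (\<lambda>x. R (S i (R x)))"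
  unfolding R_def by (rule reflect_conj_sym_contraction [OF S_sym_contraction R_vec])

lemma lin_in_Rd: "lin i \<in> Rd dim"
  by (auto simp: lin_def Rd_def)

lemma comp_smooth: "L_smooth dim (\<mu> + 2 * \<nu>) (comp i)"
  unfolding comp_def using \<mu> \<nu>
  by (intro quad_L_smooth T_sym_contraction R_in_Rd lin_in_Rd) auto

lemma comp_strongly_convex: "strongly_convex dim \<mu> (comp i)"
  unfolding comp_def using \<mu> \<nu>
  by (intro quad_strongly_convex T_sym_contraction R_in_Rd lin_in_Rd) auto

section \<open>The oracle in reflected coordinates and the growth of the support\<close>

definition cgrad :: "nat \<Rightarrow> vecn \<Rightarrow> vecn" where
  "cgrad i y = (\<lambda>j. (\<mu> + \<nu>) * y j - \<nu> * S i y j - lin i j)"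

lemma quad_grad_R:
  "quad_grad \<mu> \<nu> (\<lambda>x. R (S i (R x))) (R (lin i)) x = R (cgrad i (R x))"
  by (simp add: quad_grad_def cgrad_def R_diff R_scale R_R)

lemma grad_comp: "x \<in> Rd dim \<Longrightarrow> grad_d dim (comp i) x = R (cgrad i (R x))"
  unfolding comp_def quad_grad_R [symmetric] using \<mu> \<nu>
  by (intro grad_d_eq quad_has_grad T_sym_contraction R_in_Rd lin_in_Rd) auto

text \<open>The prox equation decouples into the 2x2 systems of the swapped pairs; the numerator of
  the solution comes from multiplying by the conjugate factor, as \<open>S i\<close> squares to a diagonal map.\<close>

definition cprox :: "nat \<Rightarrow> real \<Rightarrow> vecn \<Rightarrow> vecn" where
  "cprox i \<gamma> y = (\<lambda>j. ((1 + \<gamma> * (\<mu> + \<nu>)) * (y j + \<gamma> * lin i j)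
        + \<gamma> * \<nu> * weight i j * (y (partner i j) + \<gamma> * lin i (partner i j)))
     / ((1 + \<gamma> * (\<mu> + \<nu>))\<^sup>2 - (\<gamma> * \<nu> * weight i j)\<^sup>2))"

lemma weight_bounds: "0 < weight i j" "weight i j \<le> 1"
  using q0 q1 by (auto simp: weight_def)

lemma cprox_equation:
  assumes \<gamma>: "\<gamma> > 0"
  shows "y j - cprox i \<gamma> y j = \<gamma> * cgrad i (cprox i \<gamma> y) j"
proof -
  define A where "A = 1 + \<gamma> * (\<mu> + \<nu>)"
  define B where "B = \<gamma> * \<nu> * weight i j"
  define u where "u = y j + \<gamma> * lin i j"
  define v where "v = y (partner i j) + \<gamma> * lin i (partner i j)"
  have B: "0 < B" using \<gamma> \<nu> weight_bounds by (simp add: B_def)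
  have "B \<le> \<gamma> * \<nu>"
    using \<gamma> \<nu> weight_bounds(2) [of i j] by (simp add: B_def)
  moreover have "0 < \<gamma> * \<mu>" using \<gamma> \<mu> by simp
  ultimately have "B < A" unfolding A_def distrib_left by linarith
  then have "B\<^sup>2 < A\<^sup>2" using B by (intro power_strict_mono) auto
  then have D: "A\<^sup>2 - B\<^sup>2 \<noteq> 0" by simp
  \<comment> \<open>The system for \<open>j\<close> and its partner has the rows
    \<open>(A, -B)\<close> and \<open>(-B, A)\<close>. A fixed point of \<open>partner i\<close> has
    \<open>u = v\<close>, so the same computation covers it.\<close>
  have c: "cprox i \<gamma> y j = (A * u + B * v) / (A\<^sup>2 - B\<^sup>2)"
    by (simp add: cprox_def A_def B_def u_def v_def)
  have c': "cprox i \<gamma> y (partner i j) = (A * v + B * u) / (A\<^sup>2 - B\<^sup>2)"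
    by (simp add: cprox_def A_def B_def u_def v_def partner_partner weight_partner)
  have "A * cprox i \<gamma> y j - B * cprox i \<gamma> y (partner i j) = u"
  proof -
    have "A * (A * u + B * v) - B * (A * v + B * u) = (A\<^sup>2 - B\<^sup>2) * u"
      by (simp add: power2_eq_square algebra_simps)
    then show ?thesis using D
      unfolding c c' times_divide_eq_right diff_divide_distrib [symmetric] by simp
  qed
  then show ?thesis
    by (simp add: A_def B_def u_def cgrad_def S_def wswap_def algebra_simps)
qed

lemma cprox_in_Rd: "y \<in> Rd dim \<Longrightarrow> cprox i \<gamma> y \<in> Rd dim"
  by (auto simp: Rd_def cprox_def partner_def lin_def)

lemma prox_comp:
  assumes x: "x \<in> Rd dim" and \<gamma>: "\<gamma> > 0"
  shows "prox_d dim \<gamma> (comp i) x = R (cprox i \<gamma> (R x))"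
proof (rule prox_d_eq)
  let ?u = "R (cprox i \<gamma> (R x))"
  show u: "?u \<in> Rd dim" by (intro R_in_Rd cprox_in_Rd x)
  show "comp i ?u + inner_d dim (R (cgrad i (R ?u))) (\<lambda>j. v j - ?u j) \<le> comp i v"
    if v: "v \<in> Rd dim" for v
  proof -
    have "0 \<le> \<mu> / 2 * (norm_d dim (\<lambda>j. v j - ?u j))\<^sup>2" using \<mu> by simp
    then show ?thesis
      using quad_above_tangent [OF T_sym_contraction u v, of \<nu> \<mu> i "R (lin i)"] \<nu>
      unfolding quad_grad_R comp_def by linarith
  qed
  fix j
  have "(\<lambda>j. x j - ?u j) = R (\<lambda>j. R x j - cprox i \<gamma> (R x) j)"
    by (simp add: R_diff R_R)
  also have "\<dots> = (\<lambda>j. \<gamma> * R (cgrad i (R ?u)) j)"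
    unfolding cprox_equation [OF \<gamma>] by (simp add: R_scale R_R)
  finally show "x j - ?u j = \<gamma> * R (cgrad i (R ?u)) j" by (rule fun_cong)
qed (rule \<gamma>)

text \<open>The support is measured after reflection, and coordinate \<open>M + 1\<close> stays free
  because \<open>R x0\<close> lies there. For \<open>k > M\<close> the condition is void, so
  \<open>progress\<close> may exceed the length of the chain.\<close>

definition V :: "nat \<Rightarrow> vecn set" where
  "V k = {x \<in> Rd dim. \<forall>j. k \<le> j \<and> j \<le> M \<longrightarrow> R x j = 0}"

lemma V_mono: "k \<le> k' \<Longrightarrow> V k \<subseteq> V k'"
  by (auto simp: V_def)

lemma in_span_V:
  assumes "in_span vs x" "set vs \<subseteq> V k"
  shows "x \<in> V k"
proof -
  obtain c where x: "x = (\<lambda>k. \<Sum>j<length vs. c j * (vs ! j) k)"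
    using assms(1) by (auto simp: in_span_def)
  have vs: "vs ! j \<in> V k" if "j < length vs" for j
    using assms(2) that by auto
  have "R x = (\<lambda>k. \<Sum>j<length vs. c j * R (vs ! j) k)"
    unfolding x R_def by (rule reflect_sum)
  with vs show ?thesis by (auto simp: V_def Rd_def x)
qed

text \<open>A swap lowers a coordinate by at most one, so the tail from \<open>k\<close> can be left
  downwards only from \<open>k\<close> itself, across link \<open>k\<close>. If \<open>i\<close>
  owns that link, the claim starts at \<open>k + 1\<close>.\<close>

lemma partner_in_tail:
  assumes "(if i = link k then Suc k else k) \<le> j" "j \<le> M"
  shows "k \<le> partner i j" "partner i j \<le> M"
proof -
  show "k \<le> partner i j"
    using assms link_Suc_neq [of k] by (cases "j = k") (auto simp: partner_def split: if_splits)
  show "partner i j \<le> M" using assms by (auto simp: partner_def)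
qed

text \<open>On the chain the linear term sits at coordinate 0 of component \<open>a\<close>, which
  is \<open>link 0\<close>, so drawing it counts as the first step. The first link belongs to
  \<open>b\<close>, hence \<open>a\<close> does not carry the term on to coordinate 1.\<close>

lemma lin_tail:
  assumes "(if i = link k then Suc k else k) \<le> j" "j \<le> M"
  shows "lin i j = 0" "lin i (partner i j) = 0"
proof -
  have "partner i j \<noteq> 0" if "i = a"
  proof
    assume "partner i j = 0"
    moreover from this have "j = 0 \<or> j = 1" by (auto simp: partner_def split: if_splits)
    ultimately show False using assms that ab
      by (auto simp: partner_def link_def split: if_splits)
  qed
  moreover have "j \<noteq> 0" if "i = a"
    using assms that by (cases "k = 0") (auto simp: link_def split: if_splits)
  ultimately show "lin i j = 0" "lin i (partner i j) = 0"
    using assms partner_in_tail(2) [OF assms] by (auto simp: lin_def)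
qed

text \<open>At coordinate \<open>j\<close> both answers involve \<open>R x\<close> and
  \<open>lin i\<close> only at \<open>j\<close> and \<open>partner i j\<close>. A proximal query
  therefore spreads no further than a gradient query.\<close>

lemma oracle_in_V:
  fixes i k :: nat
  assumes x: "x \<in> V k" and \<gamma>: "\<gamma> > 0"
  defines "k' \<equiv> (if i = link k then Suc k else k)"
  shows "grad_d dim (comp i) x \<in> V k'" and "prox_d dim \<gamma> (comp i) x \<in> V k'"
proof -
  have xR: "x \<in> Rd dim" and x0: "\<And>j. k \<le> j \<Longrightarrow> j \<le> M \<Longrightarrow> R x j = 0"
    using x by (auto simp: V_def)
  have tail: "R x j = 0" "R x (partner i j) = 0" "lin i j = 0" "lin i (partner i j) = 0"
    if "k' \<le> j" "j \<le> M" for j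
    using partner_in_tail [of i k j] lin_tail [of i k j] that x0 unfolding k'_def
    by (auto split: if_splits)
  have "cgrad i (R x) \<in> Rd dim"
    using R_in_Rd [OF xR] sym_contractionD(1) [OF S_sym_contraction R_in_Rd [OF xR]] lin_in_Rd [of i]
    by (auto simp: cgrad_def Rd_def)
  then show "grad_d dim (comp i) x \<in> V k'"
    unfolding grad_comp [OF xR] using tail
    by (auto simp: V_def R_R cgrad_def S_def wswap_def intro: R_in_Rd)
  show "prox_d dim \<gamma> (comp i) x \<in> V k'"
    unfolding prox_comp [OF xR \<gamma>] using tail R_in_Rd [OF xR]
    by (auto simp: V_def R_R intro: R_in_Rd cprox_in_Rd) (simp add: cprox_def)
qed

lemma x0_in_V: "x0 \<in> V 0"
  using x0 by (auto simp: V_def R_x0 axis_def)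

text \<open>Complete induction, since the span contains every earlier iterate and every
  answer.\<close>

lemma iterate_in_V:
  assumes alg: "pifo_alg n p gam A" and start: "A dim [] = x0"
  shows "iterate A gam dim comp is t \<in> V (progress link is t)"
proof (induction t rule: less_induct)
  case (less t)
  let ?H = "hist A gam dim comp is t"
  show ?case
  proof (cases t)
    case 0
    then show ?thesis using x0_in_V start by (simp add: iterate_def)
  next
    case (Suc t')
    then have "?H \<noteq> []" using length_hist [of A gam dim comp "is" t] by force
    then have "in_span (span_gens A dim ?H) (A dim ?H)"
      using alg by (auto simp: pifo_alg_def)
    moreover have "set (span_gens A dim ?H) \<subseteq> V (progress link is t)"
    proof
      fix v assume "v \<in> set (span_gens A dim ?H)"
      then obtain s where s: "s < t" and v: "v = iterate A gam dim comp is s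
          \<or> v = fst (snd (snd (?H ! s))) \<or> v = snd (snd (snd (?H ! s)))"
        by (fastforce simp: span_gens_def length_hist take_hist iterate_def in_set_conv_nth)
      have x: "iterate A gam dim comp is s \<in> V (progress link is s)"
        using less.IH s by simp
      have gam: "gam (Suc s) > 0" using alg by (simp add: pifo_alg_def)
      \<comment> \<open>The case distinction in \<open>oracle_in_V\<close> matches the recursion of
        \<open>progress\<close>: an answer at time \<open>s\<close> reaches at most the level of
        time \<open>s + 1\<close>, which does not exceed that of \<open>t\<close>.\<close>
      have "v \<in> V (progress link is s) \<or> v \<in> V (progress link is (Suc s))"
        using v oracle_in_V [OF x gam, of "is s"] x by (auto simp: hist_nth [OF s])
      then show "v \<in> V (progress link is t)"
        using V_mono [OF progress_mono [of s t link "is"]] V_mono [OF progress_mono [of "Suc s" t link "is"]] s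
        by auto
    qed
    ultimately show ?thesis unfolding iterate_def by (rule in_span_V)
  qed
qed

section \<open>The average function, its minimizer and its gap\<close>

lemma sum_links:
  "(\<Sum>i<n. y j - S i y j) = (if j \<le> M then (if 0 < j then y j - y (j - 1) else 0)
      + (y j - (if j < M then y (Suc j) else q * y j)) else 0)"
proof (cases "j \<le> M")
  case True
  \<comment> \<open>Coordinate \<open>j\<close> belongs to links \<open>j\<close> and
    \<open>j + 1\<close>, whose owners differ; link 0 contributes nothing here, and link
    \<open>M + 1\<close> is the boundary term. All other components fix this coordinate.\<close>
  have "y j - S i y j = (if i = link j then (if 0 < j then y j - y (j - 1) else 0) else 0)
      + (if i = link (Suc j) then y j - (if j < M then y (Suc j) else q * y j) else 0)" for i
    using True link_Suc_neq [of j] link_Suc_neq [of M]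
    by (auto simp: S_def wswap_def partner_def weight_def)
  then show ?thesis using True by (simp add: sum.distrib link_less)
next
  case False
  then show ?thesis by (auto simp: S_def wswap_def partner_def weight_def)
qed

definition ystar :: vecn where
  "ystar = (\<lambda>j. if j \<le> M then W * q ^ j else if j = Suc M then norm_d dim x0 else 0)"

lemma ystar_in_Rd: "ystar \<in> Rd dim"
  by (auto simp: ystar_def Rd_def)

lemma sum_cgrad_ystar:
  assumes "j < dim"
  shows "(\<Sum>i<n. cgrad i ystar j) = 0"
proof -
  have lin: "(\<Sum>i<n. lin i j) = (if j = 0 then \<nu> * W * (1 - q) / q
      else if j = Suc M then real n * (\<mu> * norm_d dim x0) else 0)"
    using a by (auto simp: lin_def)
  have "(\<Sum>i<n. cgrad i ystar j)
      = real n * (\<mu> * ystar j) + \<nu> * (\<Sum>i<n. ystar j - S i ystar j) - (\<Sum>i<n. lin i j)"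
    unfolding cgrad_def
    by (simp add: sum_subtractf sum.distrib sum_distrib_left algebra_simps)
  also have "\<dots> = 0"
  proof (cases "j \<le> M")
    case False
    then show ?thesis using assms by (simp add: sum_links lin) (auto simp: ystar_def)
  next
    case True
    \<comment> \<open>At \<open>j = M\<close> the weight \<open>q\<close> supplies the missing
      neighbour \<open>W q^(M+1)\<close>, as if the geometric sequence continued.\<close>
    have next_eq: "(if j < M then ystar (Suc j) else q * ystar j) = W * q * q ^ j"
      using True by (auto simp: ystar_def)
    have links: "(\<Sum>i<n. ystar j - S i ystar j)
        = (if 0 < j then ystar j - ystar (j - 1) else 0) + (ystar j - W * q * q ^ j)"
      unfolding sum_links next_eq using True by simp
    have n\<mu>: "real n * \<mu> = \<nu> * (1 - q)\<^sup>2 / q"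
      using balance q0 by (simp add: field_simps)
    show ?thesis
    proof (cases j)
      case 0
      have "real n * (\<mu> * W) + \<nu> * (W - W * q) - \<nu> * W * (1 - q) / q = 0"
      proof -
        have "real n * (\<mu> * W) = \<nu> * (1 - q)\<^sup>2 / q * W" using n\<mu> by (metis mult.assoc)
        then show ?thesis using q0 by (simp add: field_simps power2_eq_square)
      qed
      then show ?thesis unfolding links lin using 0 by (simp add: ystar_def)
    next
      case (Suc j')
      have "real n * (\<mu> * (W * q ^ Suc j')) + \<nu> * ((W * q ^ Suc j' - W * q ^ j') + (W * q ^ Suc j' - W * q * q ^ Suc j'))
        = W * q ^ j' * (real n * \<mu> * q - \<nu> * (1 - q)\<^sup>2)"
        by (simp add: power2_eq_square algebra_simps)
      then show ?thesis unfolding links lin using Suc True balance by (simp add: ystar_def)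
    qed
  qed
  finally show ?thesis .
qed

text \<open>The second-order term of the average in reflected coordinates.\<close>

definition energy :: "vecn \<Rightarrow> real" where
  "energy z = \<mu> / 2 * inner_d dim z z
     + \<nu> / (2 * real n) * ((\<Sum>j<M. (z j - z (Suc j))\<^sup>2) + (1 - q) * (z M)\<^sup>2)"

text \<open>Every component has an exact second-order expansion at \<open>R ystar\<close>. In the
  sum the linear terms cancel by stationarity and the swap terms combine by
  \<open>sum_chain_by_parts\<close>.\<close>

lemma avg_gap:
  assumes x: "x \<in> Rd dim"
  shows "avg_fun n comp x - avg_fun n comp (R ystar) = energy (\<lambda>j. R x j - ystar j)"
proof -
  define h where "h = (\<lambda>j. x j - R ystar j)"
  define z where "z = (\<lambda>j. R x j - ystar j)"
  have Rh: "R h = z" by (simp add: h_def z_def R_diff R_R)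
  have xs: "R ystar \<in> Rd dim" by (intro R_in_Rd ystar_in_Rd)
  have h: "h \<in> Rd dim" using x xs by (auto simp: Rd_def h_def)
  have hh: "inner_d dim h h = inner_d dim z z"
    by (metis Rh R_R inner_d_R)
  have "comp i x - comp i (R ystar) = inner_d dim (cgrad i ystar) z
     + (\<mu> / 2 * inner_d dim z z + \<nu> / 2 * inner_d dim z (\<lambda>j. z j - S i z j))" for i
  proof -
    have "(\<lambda>j. R ystar j + h j) = x" by (simp add: h_def)
    moreover have "inner_d dim h (R (S i z)) = inner_d dim z (S i z)"
      by (simp add: inner_d_R [symmetric] Rh)
    ultimately show ?thesis
      using quad_expand [OF T_sym_contraction xs h, of \<mu> \<nu> i "R (lin i)"]
      unfolding comp_def quad_grad_R inner_d_R R_R Rh hh inner_d_diff_right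
      by (simp add: field_simps)
  qed
  then have "(\<Sum>i<n. comp i x) - (\<Sum>i<n. comp i (R ystar)) =
      (\<Sum>i<n. inner_d dim (cgrad i ystar) z) + real n * (\<mu> / 2 * inner_d dim z z)
      + \<nu> / 2 * (\<Sum>i<n. inner_d dim z (\<lambda>j. z j - S i z j))"
    unfolding sum_subtractf [symmetric] by (simp add: sum.distrib sum_distrib_left)
  also have "(\<Sum>i<n. inner_d dim (cgrad i ystar) z) = 0"
  proof -
    have "(\<Sum>i<n. inner_d dim (cgrad i ystar) z) = (\<Sum>j<dim. (\<Sum>i<n. cgrad i ystar j) * z j)"
      unfolding inner_d_def sum_distrib_right by (rule sum.swap)
    also have "\<dots> = 0" by (rule sum.neutral) (use sum_cgrad_ystar in auto)
    finally show ?thesis .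
  qed
  also have "(\<Sum>i<n. inner_d dim z (\<lambda>j. z j - S i z j)) = (\<Sum>j<M. (z j - z (Suc j))\<^sup>2) + (1 - q) * (z M)\<^sup>2"
  proof -
    have "(\<Sum>i<n. inner_d dim z (\<lambda>j. z j - S i z j)) = (\<Sum>j<dim. z j * (\<Sum>i<n. z j - S i z j))"
      unfolding inner_d_def sum_distrib_left by (rule sum.swap)
    also have "\<dots> = (\<Sum>j<Suc M. z j * ((if 0 < j then z j - z (j - 1) else 0)
        + (z j - (if j < M then z (Suc j) else q * z j))))"
      unfolding sum_links sum.lessThan_Suc [of _ "Suc M"] by (auto intro!: sum.cong)
    finally show ?thesis by (simp only: sum_chain_by_parts)
  qed
  finally show ?thesis
    using a by (simp add: avg_fun_def energy_def z_def [symmetric] diff_divide_distrib [symmetric])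
      (simp add: field_simps)
qed

lemma energy_nonneg: "0 \<le> energy z"
  unfolding energy_def using \<mu> \<nu> q1 inner_d_self_nonneg [of dim z]
  by (intro add_nonneg_nonneg mult_nonneg_nonneg divide_nonneg_nonneg sum_nonneg) auto

text \<open>The tail of a geometric sequence is self-similar: in a downward induction from
  \<open>M\<close>, adding coordinate \<open>k\<close> and its link reproduces the same
  constant.\<close>

lemma tail_energy:
  assumes "k \<le> M"
  shows "\<mu> / 2 * (\<Sum>j\<in>{k..M}. (W * q ^ j)\<^sup>2)
     + \<nu> / (2 * real n) * ((\<Sum>j\<in>{k..<M}. (W * q ^ j - W * q ^ Suc j)\<^sup>2) + (1 - q) * (W * q ^ M)\<^sup>2)
     = \<nu> * (1 - q) / (2 * real n * q) * W\<^sup>2 * q ^ (2 * k)"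
proof -
  define K where "K = \<nu> / (2 * real n)"
  have n: "real n > 0" using a by simp
  have \<mu>_eq: "\<mu> / 2 = K * ((1 - q)\<^sup>2 / q)"
    using balance n q0 by (simp add: K_def field_simps)
  \<comment> \<open>\<open>unit\<close> is the base case, one coordinate plus the boundary term;
    \<open>rec\<close> joins one coordinate, one link and the remaining tail scaled by
    \<open>q^2\<close>.\<close>
  have unit: "(1 - q)\<^sup>2 / q + (1 - q) = (1 - q) / q"
    using q0 by (simp add: field_simps power2_eq_square)
  have rec: "(1 - q)\<^sup>2 / q + (1 - q)\<^sup>2 + (1 - q) / q * q\<^sup>2 = (1 - q) / q"
    using q0 by (simp add: field_simps power2_eq_square)
  have "(1 - q)\<^sup>2 / q * (\<Sum>j\<in>{k..M}. (W * q ^ j)\<^sup>2)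
     + ((\<Sum>j\<in>{k..<M}. (W * q ^ j - W * q ^ Suc j)\<^sup>2) + (1 - q) * (W * q ^ M)\<^sup>2)
     = (1 - q) / q * (W * q ^ k)\<^sup>2"
    using assms
  proof (induction rule: inc_induct)
    case base
    then show ?case using arg_cong [OF unit, of "\<lambda>c. c * (W * q ^ M)\<^sup>2"] by (simp add: distrib_right)
  next
    case (step k)
    have "{k..M} = insert k {Suc k..M}" "{k..<M} = insert k {Suc k..<M}"
      using step.hyps by auto
    then have "(1 - q)\<^sup>2 / q * (\<Sum>j\<in>{k..M}. (W * q ^ j)\<^sup>2)
       + ((\<Sum>j\<in>{k..<M}. (W * q ^ j - W * q ^ Suc j)\<^sup>2) + (1 - q) * (W * q ^ M)\<^sup>2)
       = (1 - q)\<^sup>2 / q * (W * q ^ k)\<^sup>2 + (W * q ^ k - W * q ^ Suc k)\<^sup>2 + (1 - q) / q * (W * q ^ Suc k)\<^sup>2"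
      using step.IH by (simp add: distrib_left)
    also have "\<dots> = ((1 - q)\<^sup>2 / q + (1 - q)\<^sup>2 + (1 - q) / q * q\<^sup>2) * (W * q ^ k)\<^sup>2"
    proof -
      have "W * q ^ k - W * q ^ Suc k = (1 - q) * (W * q ^ k)"
        and "W * q ^ Suc k = q * (W * q ^ k)" by (simp_all add: algebra_simps)
      then show ?thesis by (simp only: power_mult_distrib distrib_right mult.assoc)
    qed
    finally show ?case unfolding rec .
  qed
  then have "K * ((1 - q)\<^sup>2 / q * (\<Sum>j\<in>{k..M}. (W * q ^ j)\<^sup>2)
     + ((\<Sum>j\<in>{k..<M}. (W * q ^ j - W * q ^ Suc j)\<^sup>2) + (1 - q) * (W * q ^ M)\<^sup>2))
     = K * ((1 - q) / q * (W * q ^ k)\<^sup>2)" by (simp only:)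
  moreover have "\<dots> = \<nu> * (1 - q) / (2 * real n * q) * W\<^sup>2 * q ^ (2 * k)"
    by (simp add: K_def power_mult_distrib power_mult [symmetric] mult.commute [of k])
  ultimately show ?thesis
    unfolding \<mu>_eq K_def [symmetric] by (simp only: distrib_left mult.assoc)
qed

definition gap0 :: real where
  "gap0 = \<nu> * (1 - q) / (2 * real n * q) * W\<^sup>2"

lemma avg_gap_x0: "avg_fun n comp x0 - avg_fun n comp (R ystar) = gap0"
proof -
  let ?z = "\<lambda>j. R x0 j - ystar j"
  have z: "?z j = - (W * q ^ j)" if "j \<le> M" for j
    using that by (simp add: R_x0 axis_def ystar_def)
  have zM: "?z (Suc M) = 0" by (simp add: R_x0 axis_def ystar_def)
  have "inner_d dim ?z ?z = (\<Sum>j\<in>{0..M}. (W * q ^ j)\<^sup>2)"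
    unfolding inner_d_def sum.lessThan_Suc [of _ "Suc M"] zM lessThan_Suc_atMost atLeast0AtMost
    using zM by (auto simp: z power2_eq_square intro!: sum.cong)
  moreover have "(\<Sum>j<M. (?z j - ?z (Suc j))\<^sup>2) = (\<Sum>j\<in>{0..<M}. (W * q ^ j - W * q ^ Suc j)\<^sup>2)"
    unfolding atLeast0LessThan by (rule sum.cong) (auto simp: z power2_commute)
  moreover have "(?z M)\<^sup>2 = (W * q ^ M)\<^sup>2" by (simp add: z)
  ultimately have "energy ?z = gap0"
    unfolding energy_def gap0_def using tail_energy [of 0] by (simp only:) simp
  then show ?thesis using avg_gap [OF x0] by simp
qed

text \<open>On \<open>k..M\<close> the displacement is still \<open>- W q^j\<close>, and dropping
  the other nonnegative terms of \<open>energy\<close> leaves the tail. The subtracted power makes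
  the bound hold for \<open>k > M\<close> too, where it is not positive.\<close>

lemma avg_gap_V:
  assumes x: "x \<in> V k"
  shows "avg_fun n comp x - avg_fun n comp (R ystar) \<ge> gap0 * ((q\<^sup>2) ^ k - (q\<^sup>2) ^ Suc M)"
proof -
  let ?z = "\<lambda>j. R x j - ystar j"
  have xR: "x \<in> Rd dim" using x by (simp add: V_def)
  have gap0: "gap0 \<ge> 0" unfolding gap0_def using \<nu> q0 q1 by simp
  show ?thesis
  proof (cases "k \<le> M")
    case True
    have z: "?z j = - (W * q ^ j)" if "k \<le> j" "j \<le> M" for j
      using that x by (simp add: V_def ystar_def)
    have "(\<Sum>j\<in>{k..M}. (W * q ^ j)\<^sup>2) = (\<Sum>j\<in>{k..M}. ?z j * ?z j)"
      by (rule sum.cong) (auto simp: z power2_eq_square)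
    also have "\<dots> \<le> inner_d dim ?z ?z"
      unfolding inner_d_def by (rule sum_mono2) auto
    finally have 1: "(\<Sum>j\<in>{k..M}. (W * q ^ j)\<^sup>2) \<le> inner_d dim ?z ?z" .
    have "(\<Sum>j\<in>{k..<M}. (W * q ^ j - W * q ^ Suc j)\<^sup>2) = (\<Sum>j\<in>{k..<M}. (?z j - ?z (Suc j))\<^sup>2)"
      by (rule sum.cong) (auto simp: z power2_commute)
    also have "\<dots> \<le> (\<Sum>j<M. (?z j - ?z (Suc j))\<^sup>2)"
      by (rule sum_mono2) auto
    finally have 2: "(\<Sum>j\<in>{k..<M}. (W * q ^ j - W * q ^ Suc j)\<^sup>2) \<le> (\<Sum>j<M. (?z j - ?z (Suc j))\<^sup>2)" .
    have 3: "(?z M)\<^sup>2 = (W * q ^ M)\<^sup>2" using True by (simp add: z)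
    have "gap0 * (q\<^sup>2) ^ k \<le> energy ?z"
      unfolding energy_def gap0_def 3 power_mult [symmetric] tail_energy [OF True, symmetric]
      using \<mu> \<nu> q1 by (intro add_mono mult_left_mono 1 2) auto
    moreover have "gap0 * (q\<^sup>2) ^ Suc M \<ge> 0" using gap0 by (intro mult_nonneg_nonneg) auto
    ultimately show ?thesis using avg_gap [OF xR] by (simp only: right_diff_distrib)
  next
    case False
    have "q\<^sup>2 \<le> 1" using q0 q1 by (simp add: power_le_one)
    then have "(q\<^sup>2) ^ k \<le> (q\<^sup>2) ^ Suc M"
      using False by (intro power_decreasing) auto
    then have "gap0 * ((q\<^sup>2) ^ k - (q\<^sup>2) ^ Suc M) \<le> 0"
      using gap0 by (intro mult_nonneg_nonpos) auto
    then show ?thesis using avg_gap [OF xR] energy_nonneg [of ?z] by linarith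
  qed
qed

text \<open>The bound of \<open>avg_gap_V\<close> is affine in \<open>(q^2)^k\<close>, so
  expectations reduce it to \<open>expected_power_progress_ge\<close> with
  \<open>r = q^2\<close>.\<close>

lemma expected_gap:
  assumes alg: "pifo_alg n p gam A" and start: "A dim [] = x0"
    and \<theta>: "p a \<le> \<theta>" "p b \<le> \<theta>" "\<theta> \<le> 1"
  shows "expect_iter n p gam A dim comp (avg_fun n comp) t - avg_fun n comp (R ystar)
     \<ge> gap0 * ((1 - \<theta> * (1 - q\<^sup>2)) ^ t - (q\<^sup>2) ^ Suc M)"
proof -
  let ?P = "PiE {..<t} (\<lambda>_. {..<n})"
  let ?w = "\<lambda>is. \<Prod>k<t. p (is k)"
  let ?x = "\<lambda>is. iterate A gam dim comp is t"
  have p: "\<And>j. j < n \<Longrightarrow> p j \<ge> 0" and sum: "(\<Sum>j<n. p j) = 1"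
    using alg by (auto simp: pifo_alg_def)
  have gap0: "gap0 \<ge> 0" unfolding gap0_def using \<nu> q0 q1 by simp
  have q2: "0 \<le> q\<^sup>2" "q\<^sup>2 \<le> 1" using q0 q1 by (simp_all add: power_le_one)
  have "\<theta> * (1 - q\<^sup>2) \<le> 1 * (1 - q\<^sup>2)" using q2 \<theta> by (intro mult_right_mono) auto
  also have "\<dots> \<le> 1" using q2 by simp
  finally have \<theta>': "\<theta> * (1 - q\<^sup>2) \<le> 1" .
  note W1 = sum_prod_weights_eq_1 [OF sum, of t]
  have "(1 - \<theta> * (1 - q\<^sup>2)) ^ t \<le> (\<Sum>is\<in>?P. ?w is * (q\<^sup>2) ^ progress link is t)"
    using \<theta> by (intro expected_power_progress_ge p sum link_less q2 \<theta>') (auto simp: link_def)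
  then have "gap0 * ((1 - \<theta> * (1 - q\<^sup>2)) ^ t - (q\<^sup>2) ^ Suc M)
      \<le> gap0 * ((\<Sum>is\<in>?P. ?w is * (q\<^sup>2) ^ progress link is t) - (\<Sum>is\<in>?P. ?w is) * (q\<^sup>2) ^ Suc M)"
    unfolding W1 using gap0 by (intro mult_left_mono) auto
  also have "\<dots> = (\<Sum>is\<in>?P. ?w is * (gap0 * ((q\<^sup>2) ^ progress link is t - (q\<^sup>2) ^ Suc M)))"
    unfolding sum_distrib_right sum_subtractf [symmetric] sum_distrib_left
    by (intro sum.cong) (auto simp: algebra_simps)
  also have "\<dots> \<le> (\<Sum>is\<in>?P. ?w is * (avg_fun n comp (?x is) - avg_fun n comp (R ystar)))"
    using p by (intro sum_mono mult_left_mono avg_gap_V iterate_in_V [OF alg start] prod_nonneg)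
      (auto simp: PiE_iff)
  also have "\<dots> = expect_iter n p gam A dim comp (avg_fun n comp) t - (\<Sum>is\<in>?P. ?w is) * avg_fun n comp (R ystar)"
    by (simp only: expect_iter_def right_diff_distrib sum_subtractf sum_distrib_right)
  finally show ?thesis unfolding W1 by simp
qed

end

section \<open>Choice of the parameters\<close>

text \<open>Reciprocals reduce it to
  \<open>1 / (1 - s) = 1 + s / (1 - s) <= 1 + c * s <= exp (c * s)\<close>.\<close>

lemma exp_neg_le_one_minus:
  fixes s c :: real
  assumes "0 \<le> s" "0 < c" "1 / c \<le> 1 - s"
  shows "exp (- (c * s)) \<le> 1 - s"
proof -
  have s1: "1 - s > 0" using assms by (smt (verit) divide_pos_pos)
  have "1 / (1 - s) = 1 + s / (1 - s)" using s1 by (simp add: field_simps)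
  also have "\<dots> \<le> 1 + c * s"
  proof -
    have "1 / (1 - s) \<le> c" using assms s1 by (simp add: field_simps)
    then show ?thesis using mult_left_mono [of "1 / (1 - s)" c s] assms by (simp add: mult.commute)
  qed
  also have "\<dots> \<le> exp (c * s)" by (rule exp_ge_add_one_self)
  finally have "1 \<le> exp (c * s) * (1 - s)" using s1 by (simp add: field_simps)
  then show ?thesis by (simp add: exp_minus field_simps)
qed

text \<open>\<open>X\<close> stands for \<open>ln (\<Delta> / \<epsilon>)\<close>. The summand 3
  covers rounding up the chain length and the dimension \<open>M + 2\<close>; the factor 2 leaves
  one \<open>exp (- X)\<close> to pay for the truncation of the chain.\<close>

lemma chain_parameters:
  fixes N \<kappa> X :: real
  assumes N: "N \<ge> 2" and \<kappa>: "\<kappa> \<ge> N / 2 + 1" and X: "X \<ge> 2 * ln 2" "X \<ge> 1"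
  obtains q where "0 < q" "q < 1" "2 * N * q = (\<kappa> - 1) * (1 - q)\<^sup>2"
    and "X / (2 * (1 - q)) + 3 \<le> 7 * sqrt (\<kappa> / N) * X"
    and "\<And>t::nat. real t \<le> 1 / 2400 * (N + sqrt (\<kappa> * N)) * X \<Longrightarrow>
      2 * exp (- X) \<le> (1 - 2 / N * (1 - q\<^sup>2)) ^ t"
proof -
  define \<alpha> where "\<alpha> = sqrt (1 + 2 * (\<kappa> - 1) / N)"
  define r where "r = sqrt (\<kappa> / N)"
  \<comment> \<open>The root of the balance equation in the unit interval. Since
    \<open>r <= \<alpha> <= 2 * r\<close> is shown below, \<open>1 - q = 2 / (\<alpha> + 1)\<close>
    has the order of \<open>1 / r\<close>.\<close>
  define q where "q = (\<alpha> - 1) / (\<alpha> + 1)"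
  have \<alpha>2: "\<alpha>\<^sup>2 = 1 + 2 * (\<kappa> - 1) / N" using N \<kappa> by (simp add: \<alpha>_def)
  \<comment> \<open>The condition on \<open>\<kappa>\<close> gives \<open>\<alpha>^2 >= 2\<close>,
    and \<open>4 / 3\<close> is a rational number below \<open>sqrt 2\<close>; it yields
    \<open>q >= 1 / 7\<close>.\<close>
  have \<alpha>: "\<alpha> \<ge> 4 / 3"
    unfolding \<alpha>_def using N \<kappa> by (intro real_le_rsqrt) (simp add: field_simps power2_eq_square)
  have r_le: "r \<le> \<alpha>"
    unfolding r_def \<alpha>_def using N \<kappa> by (intro real_sqrt_le_mono) (simp add: field_simps)
  have "1 + 2 * (\<kappa> - 1) / N = (N + 2 * (\<kappa> - 1)) / N" using N by (simp add: field_simps)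
  also have "\<dots> \<le> 4 * \<kappa> / N" using N \<kappa> by (intro divide_right_mono) auto
  finally have "\<alpha> \<le> sqrt (4 * (\<kappa> / N))"
    unfolding \<alpha>_def by (intro real_sqrt_le_mono) simp
  then have le_r: "\<alpha> \<le> 2 * r" by (simp only: r_def real_sqrt_mult real_sqrt_four)
  have r: "r \<ge> 1 / 2"
    unfolding r_def using N \<kappa> by (intro real_le_rsqrt) (simp add: field_simps power2_eq_square)
  have one_q: "1 - q = 2 / (\<alpha> + 1)" using \<alpha> by (simp add: q_def field_simps)
  have q7: "1 / 7 \<le> q" using \<alpha> by (simp add: q_def field_simps)
  then have q0: "0 < q" by linarith
  have "1 - q > 0" unfolding one_q using \<alpha> by simp
  then have q1: "q < 1" by simp
  have balance: "2 * N * q = (\<kappa> - 1) * (1 - q)\<^sup>2"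
  proof -
    have "2 * N * q = 2 * N * (\<alpha>\<^sup>2 - 1) / (\<alpha> + 1)\<^sup>2"
    proof -
      have "\<alpha>\<^sup>2 - 1 = (\<alpha> - 1) * (\<alpha> + 1)" by (simp add: power2_eq_square algebra_simps)
      then show ?thesis using \<alpha> by (simp add: q_def power2_eq_square)
    qed
    also have "\<dots> = (\<kappa> - 1) * (2 / (\<alpha> + 1))\<^sup>2"
      unfolding \<alpha>2 using N by (simp add: power_divide)
    finally show ?thesis by (simp only: one_q)
  qed
  have dim: "X / (2 * (1 - q)) + 3 \<le> 7 * sqrt (\<kappa> / N) * X"
  proof -
    have "X / (2 * (1 - q)) = X * (\<alpha> + 1) / 4" using \<alpha> by (simp add: one_q)
    also have "\<dots> \<le> X * (4 * r) / 4"
      using X le_r r by (intro divide_right_mono mult_left_mono) auto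
    finally have "X / (2 * (1 - q)) \<le> r * X" by (simp add: mult.commute [of r])
    moreover have "1 / 2 * 1 \<le> r * X" using r X by (intro mult_mono) auto
    ultimately show ?thesis unfolding r_def [symmetric] by linarith
  qed
  have time: "2 * exp (- X) \<le> (1 - 2 / N * (1 - q\<^sup>2)) ^ t"
    if t: "real t \<le> 1 / 2400 * (N + sqrt (\<kappa> * N)) * X" for t :: nat
  proof -
    define s where "s = 2 / N * (1 - q\<^sup>2)"
    have q2: "q\<^sup>2 \<le> 1" using q0 q1 by (simp add: power_le_one)
    have s0: "s \<ge> 0" using q2 N by (simp add: s_def)
    have "s \<le> 1 * (1 - q\<^sup>2)" unfolding s_def using q2 N by (intro mult_right_mono) auto
    moreover have "(1 / 7)\<^sup>2 \<le> q\<^sup>2" using q7 by (intro power_mono) auto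
    ultimately have "1 / 49 \<le> 1 - s" by (simp add: power2_eq_square)
    then have exp_s: "exp (- (49 * s)) \<le> 1 - s" using s0 by (intro exp_neg_le_one_minus) auto
    have "s = 2 / N * (1 + q) * (1 - q)" by (simp add: s_def power2_eq_square algebra_simps)
    also have "\<dots> \<le> 2 / N * 2 * (1 - q)"
      using q1 N by (intro mult_right_mono mult_left_mono) auto
    also have "\<dots> = 8 / (N * (\<alpha> + 1))" by (simp add: one_q)
    also have "\<dots> \<le> 8 / (N * r)"
      using r r_le N by (intro divide_left_mono mult_left_mono mult_pos_pos) auto
    finally have s_le: "s \<le> 8 / (N * r)" .
    have "sqrt (\<kappa> * N) = N * r"
    proof -
      have "\<kappa> * N = N\<^sup>2 * (\<kappa> / N)" using N by (simp add: power2_eq_square)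
      then have "sqrt (\<kappa> * N) = sqrt (N\<^sup>2) * r" by (simp only: r_def real_sqrt_mult)
      then show ?thesis using N by simp
    qed
    moreover have "N \<le> 2 * (N * r)" using r N by simp
    ultimately have "N + sqrt (\<kappa> * N) \<le> 3 * (N * r)" by simp
    \<comment> \<open>The constant is \<open>1 / (3 * 8 * 100)\<close>: the 3 is from the line above
      and the 8 from \<open>s_le\<close>. Then \<open>s * t <= X / 100\<close>, so
      \<open>49 * s * t <= X / 2 <= X - ln 2\<close>.\<close>
    then have "1 / 2400 * (N + sqrt (\<kappa> * N)) * X \<le> 1 / 2400 * (3 * (N * r)) * X"
      using X by (intro mult_right_mono mult_left_mono) auto
    also have "\<dots> = 1 / 800 * (N * r) * X" by simp
    finally have "real t \<le> 1 / 800 * (N * r) * X" using t by (rule order_trans [rotated])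
    then have "s * real t \<le> 8 / (N * r) * (1 / 800 * (N * r) * X)"
      using s_le s0 by (intro mult_mono) (use N r in auto)
    also have "\<dots> = X / 100" using N r by simp
    finally have st: "s * real t \<le> X / 100" .
    have "2 * exp (- X) = exp (ln 2 - X)" by (simp add: exp_diff exp_minus field_simps)
    also have "\<dots> \<le> exp (- (49 * s) * real t)" using st X by simp
    also have "\<dots> = exp (- (49 * s)) ^ t" by (rule exp_of_nat2_mult)
    also have "\<dots> \<le> (1 - s) ^ t" using exp_s by (intro power_mono) auto
    finally show ?thesis by (simp add: s_def)
  qed
  show thesis by (rule that [OF q0 q1 balance dim time])
qed

theorem theorem3p1:
  shows "\<exists>c>0. \<exists>C>0. \<forall>(n::nat) (L::real) (\<mu>::real) (\<Delta>::real) (\<epsilon>::real) p gam A.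
     n \<ge> 2 \<and> L > 0 \<and> \<mu> > 0 \<and> \<Delta> > 0 \<and> \<epsilon> > 0 \<and>
     L / \<mu> \<ge> real n / 2 + 1 \<and> \<epsilon> / \<Delta> \<le> 0.00327 \<and> pifo_alg n p gam A
     \<longrightarrow>
     (\<exists>(d::nat) (fs :: nat \<Rightarrow> vecn \<Rightarrow> real).
        real d \<le> C * sqrt ((L / \<mu>) / real n) * ln (\<Delta> / \<epsilon>) \<and>
        (\<forall>i<n. L_smooth d L (fs i) \<and> strongly_convex d \<mu> (fs i)) \<and>
        (\<exists>xs\<in>Rd d. (\<forall>y\<in>Rd d. avg_fun n fs xs \<le> avg_fun n fs y) \<and>
           avg_fun n fs (A d []) - avg_fun n fs xs = \<Delta> \<and>
           (\<forall>t::nat. real t \<le> c * (real n + sqrt ((L / \<mu>) * real n)) * ln (\<Delta> / \<epsilon>) \<longrightarrow>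
              expect_iter n p gam A d fs (avg_fun n fs) t - avg_fun n fs xs \<ge> \<epsilon>)))"
proof (rule exI [of _ "1 / 2400"], rule conjI, simp, rule exI [of _ 7], rule conjI, simp,
    intro allI impI)
  fix n :: nat and L \<mu> \<Delta> \<epsilon> :: real and p gam :: "nat \<Rightarrow> real" and A :: iter_rule
  assume "n \<ge> 2 \<and> L > 0 \<and> \<mu> > 0 \<and> \<Delta> > 0 \<and> \<epsilon> > 0 \<and>
     L / \<mu> \<ge> real n / 2 + 1 \<and> \<epsilon> / \<Delta> \<le> 0.00327 \<and> pifo_alg n p gam A"
  then have n: "n \<ge> 2" and \<mu>: "\<mu> > 0" and \<Delta>: "\<Delta> > 0" and \<epsilon>: "\<epsilon> > 0"
    and \<kappa>: "L / \<mu> \<ge> real n / 2 + 1" and small: "\<epsilon> / \<Delta> \<le> 0.00327" and alg: "pifo_alg n p gam A"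
    by blast+
  define X where "X = ln (\<Delta> / \<epsilon>)"
  have exp_X: "exp (- X) = \<epsilon> / \<Delta>" using \<Delta> \<epsilon> by (simp add: X_def exp_minus)
  \<comment> \<open>Since \<open>ln 4 = 2 * ln 2\<close> and \<open>exp 1 <= 3\<close>, the value 4
    gives both lower bounds on \<open>X\<close>.\<close>
  have "4 \<le> \<Delta> / \<epsilon>" using small \<Delta> \<epsilon> by (simp add: field_simps)
  then have "ln 4 \<le> X" unfolding X_def by simp
  moreover have "ln (2 ^ 2) = 2 * ln (2::real)" by (subst ln_realpow) auto
  moreover have "1 \<le> ln (4::real)"
    using exp_le by (subst ln_ge_iff) auto
  ultimately have X: "X \<ge> 2 * ln 2" "X \<ge> 1" by simp_all
  obtain q where q: "0 < q" "q < 1" and bal: "2 * real n * q = (L / \<mu> - 1) * (1 - q)\<^sup>2"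
    and dim: "X / (2 * (1 - q)) + 3 \<le> 7 * sqrt (L / \<mu> / real n) * X"
    and time: "\<And>t::nat. real t \<le> 1 / 2400 * (real n + sqrt (L / \<mu> * real n)) * X \<Longrightarrow>
      2 * exp (- X) \<le> (1 - 2 / real n * (1 - q\<^sup>2)) ^ t"
    using chain_parameters [of "real n" "L / \<mu>" X] n \<kappa> X by auto
  have p: "\<And>j. j < n \<Longrightarrow> p j \<ge> 0" "(\<Sum>j<n. p j) = 1"
    using alg by (auto simp: pifo_alg_def)
  obtain a b where ab: "a < n" "b < n" "a \<noteq> b" and pab: "p a \<le> 2 / n" "p b \<le> 2 / n"
    using two_improbable_indices [OF n p] by blast
  define \<nu> where "\<nu> = (L - \<mu>) / 2"
  have "L / \<mu> > 1" using \<kappa> n by simp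
  then have \<nu>: "\<nu> > 0" using \<mu> by (simp add: \<nu>_def field_simps)
  \<comment> \<open>The amplitude solves \<open>gap0 = \<Delta>\<close>; the next choice,
    \<open>M\<close>, is just long enough for \<open>(q^2)^M <= exp (- X)\<close>.\<close>
  define W where "W = sqrt (\<Delta> * (2 * real n * q) / (\<nu> * (1 - q)))"
  define M where "M = nat \<lceil>X / (2 * (1 - q))\<rceil>"
  \<comment> \<open>The initial point may vary with the dimension. \<open>M\<close> depends on
    \<open>q\<close> and \<open>X\<close> only, so the dimension is fixed before the initial point
    is read off.\<close>
  interpret chain n a b M q \<mu> \<nu> W "A (Suc (Suc M)) []"
  proof
    have "(L / \<mu> - 1) * \<mu> = 2 * \<nu>" using \<mu> by (simp add: \<nu>_def field_simps)
    moreover have "2 * (real n * \<mu> * q) = (L / \<mu> - 1) * \<mu> * (1 - q)\<^sup>2"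
      using arg_cong [OF bal, of "\<lambda>x. x * \<mu>"] by (simp only: ac_simps)
    ultimately have "2 * (real n * \<mu> * q) = 2 * (\<nu> * (1 - q)\<^sup>2)" by simp
    then show "real n * \<mu> * q = \<nu> * (1 - q)\<^sup>2" by simp
    show "A (Suc (Suc M)) [] \<in> Rd (Suc (Suc M))" using alg by (simp add: pifo_alg_def)
  qed (use ab q \<mu> \<nu> in auto)
  have gap0: "gap0 = \<Delta>"
  proof -
    have "W\<^sup>2 = \<Delta> * (2 * real n * q) / (\<nu> * (1 - q))"
      using \<nu> q \<Delta> by (simp add: W_def)
    then show ?thesis using \<nu> q n by (simp add: gap0_def)
  qed
  have M: "X / (2 * (1 - q)) \<le> real M" "real M \<le> X / (2 * (1 - q)) + 1"
    using q X unfolding M_def by (simp_all add: of_nat_ceiling of_nat_nat)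
  show "\<exists>(d::nat) (fs :: nat \<Rightarrow> vecn \<Rightarrow> real).
        real d \<le> 7 * sqrt ((L / \<mu>) / real n) * ln (\<Delta> / \<epsilon>) \<and>
        (\<forall>i<n. L_smooth d L (fs i) \<and> strongly_convex d \<mu> (fs i)) \<and>
        (\<exists>xs\<in>Rd d. (\<forall>y\<in>Rd d. avg_fun n fs xs \<le> avg_fun n fs y) \<and>
           avg_fun n fs (A d []) - avg_fun n fs xs = \<Delta> \<and>
           (\<forall>t::nat. real t \<le> 1 / 2400 * (real n + sqrt ((L / \<mu>) * real n)) * ln (\<Delta> / \<epsilon>) \<longrightarrow>
              expect_iter n p gam A d fs (avg_fun n fs) t - avg_fun n fs xs \<ge> \<epsilon>))"
  proof (intro exI [of _ "Suc (Suc M)"] exI [of _ comp] conjI allI impI bexI [of _ "R ystar"] ballI)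
    show "real (Suc (Suc M)) \<le> 7 * sqrt (L / \<mu> / real n) * ln (\<Delta> / \<epsilon>)"
      using dim M unfolding X_def [symmetric] by simp
    have "\<mu> + 2 * \<nu> = L" unfolding \<nu>_def by (simp add: field_simps)
    then show "L_smooth (Suc (Suc M)) L (comp i)" "strongly_convex (Suc (Suc M)) \<mu> (comp i)" for i
      using comp_smooth [of i] comp_strongly_convex [of i] by simp_all
    show "R ystar \<in> Rd (Suc (Suc M))" by (intro R_in_Rd ystar_in_Rd)
    show "avg_fun n comp (R ystar) \<le> avg_fun n comp y" if "y \<in> Rd (Suc (Suc M))" for y
      using avg_gap [OF that] energy_nonneg by (smt (verit))
    show "avg_fun n comp (A (Suc (Suc M)) []) - avg_fun n comp (R ystar) = \<Delta>"
      using avg_gap_x0 by (simp add: gap0)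
    fix t :: nat
    assume t: "real t \<le> 1 / 2400 * (real n + sqrt ((L / \<mu>) * real n)) * ln (\<Delta> / \<epsilon>)"
    have "(q\<^sup>2) ^ Suc M \<le> exp (- X)"
    proof -
      have "q \<le> exp (- (1 - q))" using exp_ge_add_one_self [of "- (1 - q)"] by simp
      then have "q ^ (2 * Suc M) \<le> exp (- (1 - q)) ^ (2 * Suc M)"
        using q by (intro power_mono) auto
      also have "\<dots> = exp (- (1 - q) * real (2 * Suc M))" by (rule exp_of_nat2_mult [symmetric])
      also have "\<dots> \<le> exp (- X)"
      proof -
        have "X \<le> real M * (2 * (1 - q))" using M(1) q by (simp add: pos_divide_le_eq)
        also have "\<dots> \<le> real (Suc M) * (2 * (1 - q))" using q by (intro mult_right_mono) auto
        finally show ?thesis by (simp add: algebra_simps)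
      qed
      finally show ?thesis by (simp only: power_mult)
    qed
    then have "exp (- X) \<le> (1 - 2 / real n * (1 - q\<^sup>2)) ^ t - (q\<^sup>2) ^ Suc M"
      using time [of t] t unfolding X_def [symmetric] by linarith
    then have "\<Delta> * exp (- X) \<le> \<Delta> * ((1 - 2 / real n * (1 - q\<^sup>2)) ^ t - (q\<^sup>2) ^ Suc M)"
      using \<Delta> by (intro mult_left_mono) auto
    also have "\<dots> \<le> expect_iter n p gam A (Suc (Suc M)) comp (avg_fun n comp) t - avg_fun n comp (R ystar)"
      using expected_gap [OF alg refl pab, of t] n by (simp add: gap0)
    finally show "\<epsilon> \<le> expect_iter n p gam A (Suc (Suc M)) comp (avg_fun n comp) t - avg_fun n comp (R ystar)"
      using \<Delta> by (simp add: exp_X)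
  qed
qed

end
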